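(* Let $\mathscr{C}$ be a small skeletal category, $\mathcal{O}$ a presheaf of associative rings on $\mathscr{C}^{\mathrm{op}}$, and $J$ a rule satisfying the stability axiom. Then: (1) $(\mathcal{T}(J), \mathcal{F}(J))$ is a hereditary torsion pair in $\mathcal{O}\text{-Mod}$ if $J$ is a Grothendieck topology on $\mathscr{C}^{\mathrm{op}}$. (2) Conversely, if $J$ is closed under inclusions and $(\mathcal{T}(J), \mathcal{F}(J))$ is a hereditary torsion pair in $\mathcal{O}\text{-Mod}$, then $J$ is a Grothendieck topology on $\mathscr{C}^{\mathrm{op}}$.
   Context: A rule $J$ assigns to each object $x$ of $\mathscr{C}$ a collection $J(x)$ of subfunctors of $\mathscr{C}(x,-)$ (i.e. sets of morphisms with domain $x$ closed under post-composition; the empty one is allowed). For $f: x \to y$ and $S \subseteq \mathscr{C}(x,-)$ put $f^{\ast}(S) = \{ g: y \to \bullet \mid gf \in S\}$. $J$ satisfies the maximal axiom if $\mathscr{C}(x,-) \in J(x)$ for all $x$; the stability axiom if $S \in J(x)$ implies $f^{\ast}(S) \in J(y)$ for every $f: x \to y$; the transitivity axiom if whenever $S \in J(x)$ and $T \subseteq \mathscr{C}(x,-)$ is a subfunctor with $f^{\ast}(T) \in J(y)$ for every $(f: x \to y) \in S$, then $T \in J(x)$. $J$ is a Grothendieck topology on $\mathscr{C}^{\mathrm{op}}$ if it satisfies all three. $J$ is closed under inclusions if $S_2 \subseteq S_1 \subseteq \mathscr{C}(x,-)$ and $S_2 \in J(x)$ imply $S_1 \in J(x)$. A presheaf of rings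 on $\mathscr{C}^{\mathrm{op}}$ is a covariant functor $\mathcal{O}$ from $\mathscr{C}$ to associative rings. An $\mathcal{O}$-module is a covariant functor $V: \mathscr{C} \to \mathrm{Ab}$ such that each $V_x$ is a left $\mathcal{O}_x$-module and each $V_f: V_x \to V_y$ is $\mathcal{O}_x$-linear, $V_y$ being an $\mathcal{O}_x$-module via $\mathcal{O}_f$. $\mathcal{O}\text{-Mod}$ is the category of $\mathcal{O}$-modules. For $S \in J(x)$ let $\mathcal{T}_S(V) = \{v \in V_x \mid V_f(v) = 0 \text{ for all } f \in S\}$ (so $\mathcal{T}_\emptyset(V) = V_x$). The submodule $\mathcal{T}_J(V) \subseteq V$ has value $\sum_{S \in J(x)} \mathcal{T}_S(V)$ at $x$. $V$ is $J$-torsion if $\mathcal{T}_J(V) = V$ and $J$-torsion free if $\mathcal{T}_J(V) = 0$; $\mathcal{T}(J)$ and $\mathcal{F}(J)$ are the full subcategories of $J$-torsion and $J$-torsion free modules. A torsion pair is hereditary if its torsion class is closed under submodules.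
   Formalization: Part (2) is false as stated; it is proved under the added assumptions that every J(x) is nonempty and closed under binary intersections (both automatic for Grothendieck topologies) and that every ring O_x is nonzero. Rings and modules are unital. *)

theory Defs
  imports "HOL-Algebra.Module"
begin

record ('o, 'm) cat =
  Obj :: "'o set"
  Arr :: "'m set"
  Dom :: "'m \<Rightarrow> 'o"
  Cod :: "'m \<Rightarrow> 'o"
  Ident :: "'o \<Rightarrow> 'm"
  Comp :: "'m \<Rightarrow> 'm \<Rightarrow> 'm"

text \<open>\<open>Comp C g f\<close> is the composite \<open>g \<circ> f\<close>; it is meaningful only if \<open>Cod C f = Dom C g\<close>.\<close>

locale category =
  fixes C :: "('o, 'm) cat"
  assumes Dom_closed: "f \<in> Arr C \<Longrightarrow> Dom C f \<in> Obj C"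
    and Cod_closed: "f \<in> Arr C \<Longrightarrow> Cod C f \<in> Obj C"
    and Ident_arr: "x \<in> Obj C \<Longrightarrow>
          Ident C x \<in> Arr C \<and> Dom C (Ident C x) = x \<and> Cod C (Ident C x) = x"
    and Comp_arr: "\<lbrakk>f \<in> Arr C; g \<in> Arr C; Cod C f = Dom C g\<rbrakk> \<Longrightarrow>
          Comp C g f \<in> Arr C \<and> Dom C (Comp C g f) = Dom C f \<and> Cod C (Comp C g f) = Cod C g"
    and Comp_Ident_right: "f \<in> Arr C \<Longrightarrow> Comp C f (Ident C (Dom C f)) = f"
    and Comp_Ident_left: "f \<in> Arr C \<Longrightarrow> Comp C (Ident C (Cod C f)) f = f"
    and Comp_assoc: "\<lbrakk>f \<in> Arr C; g \<in> Arr C; h \<in> Arr C; Cod C f = Dom C g; Cod C g = Dom C h\<rbrakk> \<Longrightarrow>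
          Comp C h (Comp C g f) = Comp C (Comp C h g) f"

definition isomorphic_objects :: "('o, 'm) cat \<Rightarrow> 'o \<Rightarrow> 'o \<Rightarrow> bool" where
  "isomorphic_objects C x y \<longleftrightarrow>
     (\<exists>f\<in>Arr C. \<exists>g\<in>Arr C. Dom C f = x \<and> Cod C f = y \<and> Dom C g = y \<and> Cod C g = x \<and>
        Comp C g f = Ident C x \<and> Comp C f g = Ident C y)"

definition skeletal :: "('o, 'm) cat \<Rightarrow> bool" where
  "skeletal C \<longleftrightarrow> (\<forall>x\<in>Obj C. \<forall>y\<in>Obj C. isomorphic_objects C x y \<longrightarrow> x = y)"

text \<open>The covariant representable functor \<open>C(x,-)\<close> is identified with the set of all morphisms
  with domain \<open>x\<close>, and its subfunctors with the subsets closed under post-composition.\<close>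

definition representable :: "('o, 'm) cat \<Rightarrow> 'o \<Rightarrow> 'm set" where
  "representable C x = {f \<in> Arr C. Dom C f = x}"

definition subfunctor :: "('o, 'm) cat \<Rightarrow> 'o \<Rightarrow> 'm set \<Rightarrow> bool" where
  "subfunctor C x S \<longleftrightarrow> S \<subseteq> representable C x \<and>
     (\<forall>f\<in>S. \<forall>g\<in>Arr C. Dom C g = Cod C f \<longrightarrow> Comp C g f \<in> S)"

definition pullback :: "('o, 'm) cat \<Rightarrow> 'm \<Rightarrow> 'm set \<Rightarrow> 'm set" where
  "pullback C f S = {g \<in> representable C (Cod C f). Comp C g f \<in> S}"

definition is_rule :: "('o, 'm) cat \<Rightarrow> ('o \<Rightarrow> 'm set set) \<Rightarrow> bool" where
  "is_rule C J \<longleftrightarrow> (\<forall>x\<in>Obj C. \<forall>S\<in>J x. subfunctor C x S)"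

definition maximal_axiom :: "('o, 'm) cat \<Rightarrow> ('o \<Rightarrow> 'm set set) \<Rightarrow> bool" where
  "maximal_axiom C J \<longleftrightarrow> (\<forall>x\<in>Obj C. representable C x \<in> J x)"

definition stability_axiom :: "('o, 'm) cat \<Rightarrow> ('o \<Rightarrow> 'm set set) \<Rightarrow> bool" where
  "stability_axiom C J \<longleftrightarrow>
     (\<forall>x\<in>Obj C. \<forall>S\<in>J x. \<forall>f\<in>representable C x. pullback C f S \<in> J (Cod C f))"

definition transitivity_axiom :: "('o, 'm) cat \<Rightarrow> ('o \<Rightarrow> 'm set set) \<Rightarrow> bool" where
  "transitivity_axiom C J \<longleftrightarrow>
     (\<forall>x\<in>Obj C. \<forall>S\<in>J x. \<forall>T. subfunctor C x T \<longrightarrow>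
        (\<forall>f\<in>S. pullback C f T \<in> J (Cod C f)) \<longrightarrow> T \<in> J x)"

definition grothendieck_topology :: "('o, 'm) cat \<Rightarrow> ('o \<Rightarrow> 'm set set) \<Rightarrow> bool" where
  "grothendieck_topology C J \<longleftrightarrow>
     is_rule C J \<and> maximal_axiom C J \<and> stability_axiom C J \<and> transitivity_axiom C J"

definition closed_under_inclusions :: "('o, 'm) cat \<Rightarrow> ('o \<Rightarrow> 'm set set) \<Rightarrow> bool" where
  "closed_under_inclusions C J \<longleftrightarrow>
     (\<forall>x\<in>Obj C. \<forall>S1 S2. subfunctor C x S1 \<longrightarrow> subfunctor C x S2 \<longrightarrow> S2 \<subseteq> S1 \<longrightarrow> S2 \<in> J x \<longrightarrow> S1 \<in> J x)"

text \<open>Rings are associative and unital, not necessarily commutative, and possibly zero;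
  ring homomorphisms preserve the unit.\<close>

record ('o, 'm, 'r) rpsh =
  ring_at :: "'o \<Rightarrow> 'r ring"
  ring_map :: "'m \<Rightarrow> 'r \<Rightarrow> 'r"

locale ring_presheaf = category C for C :: "('o, 'm) cat" +
  fixes R :: "('o, 'm, 'r) rpsh"
  assumes ring_at: "x \<in> Obj C \<Longrightarrow> ring (ring_at R x)"
    and ring_map: "f \<in> Arr C \<Longrightarrow>
          ring_map R f \<in> ring_hom (ring_at R (Dom C f)) (ring_at R (Cod C f))"
    and ring_map_Ident: "\<lbrakk>x \<in> Obj C; a \<in> carrier (ring_at R x)\<rbrakk> \<Longrightarrow> ring_map R (Ident C x) a = a"
    and ring_map_Comp: "\<lbrakk>f \<in> Arr C; g \<in> Arr C; Cod C f = Dom C g; a \<in> carrier (ring_at R (Dom C f))\<rbrakk> \<Longrightarrow>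
          ring_map R (Comp C g f) a = ring_map R g (ring_map R f a)"

text \<open>The library locale \<open>module\<close> requires a commutative ring. As there, the multiplicative
  fields of the record \<open>M\<close> carry no meaning.\<close>

locale left_module = R?: ring R + M?: abelian_group M
  for R :: "'r ring" and M :: "('r, 'v) module" (structure) +
  assumes smult_closed:
      "\<lbrakk>a \<in> carrier R; v \<in> carrier M\<rbrakk> \<Longrightarrow> a \<odot>\<^bsub>M\<^esub> v \<in> carrier M"
    and smult_l_distr: "\<lbrakk>a \<in> carrier R; b \<in> carrier R; v \<in> carrier M\<rbrakk> \<Longrightarrow>
      (a \<oplus>\<^bsub>R\<^esub> b) \<odot>\<^bsub>M\<^esub> v = a \<odot>\<^bsub>M\<^esub> v \<oplus>\<^bsub>M\<^esub> b \<odot>\<^bsub>M\<^esub> v"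
    and smult_r_distr: "\<lbrakk>a \<in> carrier R; v \<in> carrier M; w \<in> carrier M\<rbrakk> \<Longrightarrow>
      a \<odot>\<^bsub>M\<^esub> (v \<oplus>\<^bsub>M\<^esub> w) = a \<odot>\<^bsub>M\<^esub> v \<oplus>\<^bsub>M\<^esub> a \<odot>\<^bsub>M\<^esub> w"
    and smult_assoc1: "\<lbrakk>a \<in> carrier R; b \<in> carrier R; v \<in> carrier M\<rbrakk> \<Longrightarrow>
      (a \<otimes>\<^bsub>R\<^esub> b) \<odot>\<^bsub>M\<^esub> v = a \<odot>\<^bsub>M\<^esub> (b \<odot>\<^bsub>M\<^esub> v)"
    and smult_one: "v \<in> carrier M \<Longrightarrow> \<one>\<^bsub>R\<^esub> \<odot>\<^bsub>M\<^esub> v = v"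

record ('o, 'm, 'r, 'v) omod =
  mod_at :: "'o \<Rightarrow> ('r, 'v) module"
  mod_map :: "'m \<Rightarrow> 'v \<Rightarrow> 'v"

locale o_module = ring_presheaf C R
  for C :: "('o, 'm) cat" and R :: "('o, 'm, 'r) rpsh" +
  fixes V :: "('o, 'm, 'r, 'v) omod"
  assumes mod_at: "x \<in> Obj C \<Longrightarrow> left_module (ring_at R x) (mod_at V x)"
    and mod_map_closed: "\<lbrakk>f \<in> Arr C; v \<in> carrier (mod_at V (Dom C f))\<rbrakk> \<Longrightarrow>
          mod_map V f v \<in> carrier (mod_at V (Cod C f))"
    and mod_map_add: "\<lbrakk>f \<in> Arr C; v \<in> carrier (mod_at V (Dom C f)); w \<in> carrier (mod_at V (Dom C f))\<rbrakk> \<Longrightarrow>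
          mod_map V f (v \<oplus>\<^bsub>mod_at V (Dom C f)\<^esub> w) = mod_map V f v \<oplus>\<^bsub>mod_at V (Cod C f)\<^esub> mod_map V f w"
    and mod_map_smult: "\<lbrakk>f \<in> Arr C; a \<in> carrier (ring_at R (Dom C f)); v \<in> carrier (mod_at V (Dom C f))\<rbrakk> \<Longrightarrow>
          mod_map V f (a \<odot>\<^bsub>mod_at V (Dom C f)\<^esub> v) = ring_map R f a \<odot>\<^bsub>mod_at V (Cod C f)\<^esub> mod_map V f v"
    and mod_map_Ident: "\<lbrakk>x \<in> Obj C; v \<in> carrier (mod_at V x)\<rbrakk> \<Longrightarrow> mod_map V (Ident C x) v = v"
    and mod_map_Comp: "\<lbrakk>f \<in> Arr C; g \<in> Arr C; Cod C f = Dom C g; v \<in> carrier (mod_at V (Dom C f))\<rbrakk> \<Longrightarrow>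
          mod_map V (Comp C g f) v = mod_map V g (mod_map V f v)"

text \<open>The class of all modules whose elements are drawn from the type \<open>'v\<close>.\<close>

definition O_Mod :: "('o, 'm) cat \<Rightarrow> ('o, 'm, 'r) rpsh \<Rightarrow> ('o, 'm, 'r, 'v) omod set" where
  "O_Mod C R = {V. o_module C R V}"

definition O_hom :: "('o, 'm) cat \<Rightarrow> ('o, 'm, 'r) rpsh \<Rightarrow> ('o, 'm, 'r, 'v) omod \<Rightarrow>
    ('o, 'm, 'r, 'v) omod \<Rightarrow> ('o \<Rightarrow> 'v \<Rightarrow> 'v) set" where
  "O_hom C R V W = {\<eta>.
     (\<forall>x\<in>Obj C. \<forall>v\<in>carrier (mod_at V x). \<eta> x v \<in> carrier (mod_at W x)) \<and>
     (\<forall>x\<in>Obj C. \<forall>v\<in>carrier (mod_at V x). \<forall>w\<in>carrier (mod_at V x).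
        \<eta> x (v \<oplus>\<^bsub>mod_at V x\<^esub> w) = \<eta> x v \<oplus>\<^bsub>mod_at W x\<^esub> \<eta> x w) \<and>
     (\<forall>x\<in>Obj C. \<forall>a\<in>carrier (ring_at R x). \<forall>v\<in>carrier (mod_at V x).
        \<eta> x (a \<odot>\<^bsub>mod_at V x\<^esub> v) = a \<odot>\<^bsub>mod_at W x\<^esub> \<eta> x v) \<and>
     (\<forall>f\<in>Arr C. \<forall>v\<in>carrier (mod_at V (Dom C f)).
        \<eta> (Cod C f) (mod_map V f v) = mod_map W f (\<eta> (Dom C f) v))}"

definition zero_hom :: "('o, 'm) cat \<Rightarrow> ('o, 'm, 'r, 'v) omod \<Rightarrow>
    ('o, 'm, 'r, 'v) omod \<Rightarrow> ('o \<Rightarrow> 'v \<Rightarrow> 'v) \<Rightarrow> bool" where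
  "zero_hom C V W \<eta> \<longleftrightarrow> (\<forall>x\<in>Obj C. \<forall>v\<in>carrier (mod_at V x). \<eta> x v = \<zero>\<^bsub>mod_at W x\<^esub>)"

text \<open>Monomorphisms, epimorphisms and exactness in the module category are objectwise.\<close>

definition isomorphic_modules :: "('o, 'm) cat \<Rightarrow> ('o, 'm, 'r) rpsh \<Rightarrow>
    ('o, 'm, 'r, 'v) omod \<Rightarrow> ('o, 'm, 'r, 'v) omod \<Rightarrow> bool" where
  "isomorphic_modules C R V W \<longleftrightarrow>
     (\<exists>\<eta>\<in>O_hom C R V W. \<forall>x\<in>Obj C. bij_betw (\<eta> x) (carrier (mod_at V x)) (carrier (mod_at W x)))"

definition short_exact :: "('o, 'm) cat \<Rightarrow> ('o, 'm, 'r) rpsh \<Rightarrow>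
    ('o, 'm, 'r, 'v) omod \<Rightarrow> ('o \<Rightarrow> 'v \<Rightarrow> 'v) \<Rightarrow> ('o, 'm, 'r, 'v) omod \<Rightarrow>
    ('o \<Rightarrow> 'v \<Rightarrow> 'v) \<Rightarrow> ('o, 'm, 'r, 'v) omod \<Rightarrow> bool" where
  "short_exact C R A \<alpha> V \<beta> B \<longleftrightarrow> \<alpha> \<in> O_hom C R A V \<and> \<beta> \<in> O_hom C R V B \<and>
     (\<forall>x\<in>Obj C. inj_on (\<alpha> x) (carrier (mod_at A x)) \<and>
        \<alpha> x ` carrier (mod_at A x) = {v \<in> carrier (mod_at V x). \<beta> x v = \<zero>\<^bsub>mod_at B x\<^esub>} \<and>
        \<beta> x ` carrier (mod_at V x) = carrier (mod_at B x))"

definition o_submodule :: "('o, 'm) cat \<Rightarrow> ('o, 'm, 'r) rpsh \<Rightarrow>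
    ('o \<Rightarrow> 'v set) \<Rightarrow> ('o, 'm, 'r, 'v) omod \<Rightarrow> bool" where
  "o_submodule C R U V \<longleftrightarrow>
     (\<forall>x\<in>Obj C. submodule (U x) (ring_at R x) (mod_at V x)) \<and>
     (\<forall>f\<in>Arr C. \<forall>v\<in>U (Dom C f). mod_map V f v \<in> U (Cod C f))"

definition restrict_module :: "('o, 'm, 'r, 'v) omod \<Rightarrow> ('o \<Rightarrow> 'v set) \<Rightarrow> ('o, 'm, 'r, 'v) omod" where
  "restrict_module V U = V\<lparr>mod_at := \<lambda>x. (mod_at V x)\<lparr>carrier := U x\<rparr>\<rparr>"

definition annihilated_part :: "('o, 'm) cat \<Rightarrow> ('o, 'm, 'r, 'v) omod \<Rightarrow> 'o \<Rightarrow> 'm set \<Rightarrow> 'v set" where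
  "annihilated_part C V x S =
     {v \<in> carrier (mod_at V x). \<forall>f\<in>S. mod_map V f v = \<zero>\<^bsub>mod_at V (Cod C f)\<^esub>}"

text \<open>The internal sum of the subgroups \<open>annihilated_part C V x S\<close>, where \<open>S\<close> runs through the
  possibly infinite (or empty) set \<open>J x\<close>: all finite sums of their elements.\<close>

definition torsion_part :: "('o, 'm) cat \<Rightarrow> ('o \<Rightarrow> 'm set set) \<Rightarrow>
    ('o, 'm, 'r, 'v) omod \<Rightarrow> 'o \<Rightarrow> 'v set" where
  "torsion_part C J V x = {finsum (mod_at V x) t F | t F.
     finite F \<and> F \<subseteq> J x \<and> (\<forall>S\<in>F. t S \<in> annihilated_part C V x S)}"

definition torsion_class :: "('o, 'm) cat \<Rightarrow> ('o, 'm, 'r) rpsh \<Rightarrow> ('o \<Rightarrow> 'm set set) \<Rightarrow>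
    ('o, 'm, 'r, 'v) omod set" where
  "torsion_class C R J =
     {V \<in> O_Mod C R. \<forall>x\<in>Obj C. torsion_part C J V x = carrier (mod_at V x)}"

definition torsion_free_class :: "('o, 'm) cat \<Rightarrow> ('o, 'm, 'r) rpsh \<Rightarrow> ('o \<Rightarrow> 'm set set) \<Rightarrow>
    ('o, 'm, 'r, 'v) omod set" where
  "torsion_free_class C R J =
     {V \<in> O_Mod C R. \<forall>x\<in>Obj C. torsion_part C J V x = {\<zero>\<^bsub>mod_at V x\<^esub>}}"

text \<open>Full subcategories are given by their classes of objects. A torsion pair consists of two
  full subcategories closed under isomorphism, without nonzero morphisms from the first to the
  second, such that every module is an extension of a module in the second by one in the first.\<close>

definition replete :: "('o, 'm) cat \<Rightarrow> ('o, 'm, 'r) rpsh \<Rightarrow> ('o, 'm, 'r, 'v) omod set \<Rightarrow> bool" where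
  "replete C R \<X> \<longleftrightarrow>
     (\<forall>V\<in>\<X>. \<forall>W\<in>O_Mod C R. isomorphic_modules C R V W \<longrightarrow> W \<in> \<X>)"

definition torsion_pair :: "('o, 'm) cat \<Rightarrow> ('o, 'm, 'r) rpsh \<Rightarrow>
    ('o, 'm, 'r, 'v) omod set \<Rightarrow> ('o, 'm, 'r, 'v) omod set \<Rightarrow> bool" where
  "torsion_pair C R \<T> \<F> \<longleftrightarrow>
     \<T> \<subseteq> O_Mod C R \<and> \<F> \<subseteq> O_Mod C R \<and> replete C R \<T> \<and> replete C R \<F> \<and>
     (\<forall>V\<in>\<T>. \<forall>W\<in>\<F>. \<forall>\<eta>\<in>O_hom C R V W. zero_hom C V W \<eta>) \<and>
     (\<forall>V\<in>O_Mod C R. \<exists>A\<in>\<T>. \<exists>B\<in>\<F>. \<exists>\<alpha> \<beta>. short_exact C R A \<alpha> V \<beta> B)"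

definition hereditary_torsion_pair :: "('o, 'm) cat \<Rightarrow> ('o, 'm, 'r) rpsh \<Rightarrow>
    ('o, 'm, 'r, 'v) omod set \<Rightarrow> ('o, 'm, 'r, 'v) omod set \<Rightarrow> bool" where
  "hereditary_torsion_pair C R \<T> \<F> \<longleftrightarrow> torsion_pair C R \<T> \<F> \<and>
     (\<forall>V\<in>\<T>. \<forall>U. o_submodule C R U V \<longrightarrow> restrict_module V U \<in> \<T>)"

end

theory Submission
  imports Defs "HOL-Algebra.AbelCoset"
begin

text \<open>If \<open>J\<close> is nonempty and closed under binary intersections, then \<open>\<T>\<^sub>J(V)\<close> at \<open>x\<close> consists of the
  elements killed by a single \<open>S \<in> J x\<close>. For a Grothendieck topology this is a submodule, and
  transitivity makes the quotient by it torsion free: if every \<open>f v\<close> with \<open>f \<in> S\<close> is torsion, then the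
  annihilator of \<open>v\<close> is covering. Conversely, let \<open>S \<in> J x\<close> and let \<open>T\<close> be such that every pullback
  along \<open>f \<in> S\<close> is covering. Take a module with an element \<open>v\<close> whose annihilator is exactly \<open>T\<close>. Each
  \<open>f v\<close> with \<open>f \<in> S\<close> is torsion, so the image of \<open>v\<close> in the torsion-free quotient is killed by \<open>S\<close>,
  hence zero. Thus \<open>v\<close> itself is torsion, and \<open>T\<close> contains a member of \<open>J x\<close>.\<close>

section \<open>Left modules over a possibly noncommutative ring\<close>

context left_module
begin

lemma smult_r_null: "a \<in> carrier R \<Longrightarrow> a \<odot>\<^bsub>M\<^esub> \<zero>\<^bsub>M\<^esub> = \<zero>\<^bsub>M\<^esub>"
  by (metis M.add.r_cancel_one' M.zero_closed M.l_zero smult_closed smult_r_distr)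

end

lemma left_moduleI:
  assumes "ring R" "abelian_group M"
    and "\<And>a v. \<lbrakk>a \<in> carrier R; v \<in> carrier M\<rbrakk> \<Longrightarrow> a \<odot>\<^bsub>M\<^esub> v \<in> carrier M"
    and "\<And>a b v. \<lbrakk>a \<in> carrier R; b \<in> carrier R; v \<in> carrier M\<rbrakk> \<Longrightarrow>
      (a \<oplus>\<^bsub>R\<^esub> b) \<odot>\<^bsub>M\<^esub> v = a \<odot>\<^bsub>M\<^esub> v \<oplus>\<^bsub>M\<^esub> b \<odot>\<^bsub>M\<^esub> v"
    and "\<And>a v w. \<lbrakk>a \<in> carrier R; v \<in> carrier M; w \<in> carrier M\<rbrakk> \<Longrightarrow>
      a \<odot>\<^bsub>M\<^esub> (v \<oplus>\<^bsub>M\<^esub> w) = a \<odot>\<^bsub>M\<^esub> v \<oplus>\<^bsub>M\<^esub> a \<odot>\<^bsub>M\<^esub> w"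
    and "\<And>a b v. \<lbrakk>a \<in> carrier R; b \<in> carrier R; v \<in> carrier M\<rbrakk> \<Longrightarrow>
      (a \<otimes>\<^bsub>R\<^esub> b) \<odot>\<^bsub>M\<^esub> v = a \<odot>\<^bsub>M\<^esub> (b \<odot>\<^bsub>M\<^esub> v)"
    and "\<And>v. v \<in> carrier M \<Longrightarrow> \<one>\<^bsub>R\<^esub> \<odot>\<^bsub>M\<^esub> v = v"
  shows "left_module R M"
  by (intro left_module.intro left_module_axioms.intro assms)

section \<open>Subfunctors of representables and consequences of the topology axioms\<close>

context category
begin

lemma representable_closed:
  "\<lbrakk>f \<in> representable C x; g \<in> representable C (Cod C f)\<rbrakk> \<Longrightarrow>
     Comp C g f \<in> representable C x \<and> Cod C (Comp C g f) = Cod C g"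
  using Comp_arr by (auto simp: representable_def)

lemma subfunctor_representable: "subfunctor C x (representable C x)"
  using representable_closed by (auto simp: subfunctor_def representable_def)

lemma subfunctor_pullback:
  assumes "subfunctor C x S" "f \<in> representable C x"
  shows "subfunctor C (Cod C f) (pullback C f S)"
  using assms Comp_arr Comp_assoc
  by (auto simp: subfunctor_def pullback_def representable_def)

text \<open>Closure of \<open>S\<close> under post-composition puts every composite starting with
  \<open>f\<close> into \<open>S\<close>. This lets the maximal axiom feed the transitivity
  axiom.\<close>

lemma pullback_of_mem:
  assumes "subfunctor C x S" "f \<in> S"
  shows "pullback C f S = representable C (Cod C f)"
  using assms by (auto simp: subfunctor_def pullback_def representable_def)

lemma subfunctor_Int: "\<lbrakk>subfunctor C x S; subfunctor C x T\<rbrakk> \<Longrightarrow> subfunctor C x (S \<inter> T)"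
  by (auto simp: subfunctor_def)

lemma subfunctor_subset: "subfunctor C x S \<Longrightarrow> f \<in> S \<Longrightarrow> f \<in> Arr C \<and> Dom C f = x"
  by (auto simp: subfunctor_def representable_def)

text \<open>Transitivity is tested along \<open>S2\<close>: for \<open>f\<close> in
  \<open>S2\<close>, hence in \<open>S1\<close>, the pullback of \<open>S1\<close> is a whole
  representable, which is covering by maximality.\<close>

lemma grothendieck_closed_under_inclusions:
  assumes "grothendieck_topology C J"
  shows "closed_under_inclusions C J"
  unfolding closed_under_inclusions_def
proof (intro ballI allI impI)
  fix x S1 S2
  assume x: "x \<in> Obj C" and S: "subfunctor C x S1" "subfunctor C x S2" "S2 \<subseteq> S1" "S2 \<in> J x"
  have "pullback C f S1 \<in> J (Cod C f)" if "f \<in> S2" for f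
    using that S assms pullback_of_mem[of x S1 f] subfunctor_subset[of x S2 f] Cod_closed
    by (auto simp: grothendieck_topology_def maximal_axiom_def)
  then show "S1 \<in> J x"
    using S x assms by (auto simp: grothendieck_topology_def transitivity_axiom_def)
qed

text \<open>Transitivity is tested along \<open>S\<close>, and stability supplies the pullbacks of
  \<open>T\<close>.\<close>

lemma grothendieck_Int:
  assumes J: "grothendieck_topology C J" and x: "x \<in> Obj C" and S: "S \<in> J x" and T: "T \<in> J x"
  shows "S \<inter> T \<in> J x"
proof -
  have sub: "subfunctor C x S" "subfunctor C x T"
    using J x S T by (auto simp: grothendieck_topology_def is_rule_def)
  have "pullback C f (S \<inter> T) \<in> J (Cod C f)" if f: "f \<in> S" for f
  proof -
    \<comment> \<open>Composites starting with \<open>f\<close> lie in \<open>S\<close> anyway, so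
      only the condition imposed by \<open>T\<close> remains.\<close>
    have "pullback C f (S \<inter> T) = pullback C f T"
      using pullback_of_mem[OF sub(1) f] by (auto simp: pullback_def)
    then show ?thesis
      using J x T f sub by (auto simp: grothendieck_topology_def stability_axiom_def subfunctor_def)
  qed
  then show ?thesis
    using J x S subfunctor_Int[OF sub] by (auto simp: grothendieck_topology_def transitivity_axiom_def)
qed

end

section \<open>Preservation of zero and negatives by structure maps and morphisms\<close>

context o_module
begin

lemma mod_map_zero:
  assumes f: "f \<in> Arr C"
  shows "mod_map V f \<zero>\<^bsub>mod_at V (Dom C f)\<^esub> = \<zero>\<^bsub>mod_at V (Cod C f)\<^esub>"
proof -
  interpret D: left_module "ring_at R (Dom C f)" "mod_at V (Dom C f)"
    by (rule mod_at[OF Dom_closed[OF f]])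
  interpret E: left_module "ring_at R (Cod C f)" "mod_at V (Cod C f)"
    by (rule mod_at[OF Cod_closed[OF f]])
  show ?thesis
    by (metis D.M.zero_closed D.M.l_zero E.M.add.r_cancel_one' f mod_map_add mod_map_closed)
qed

lemma mod_map_minus:
  assumes f: "f \<in> Arr C" and v: "v \<in> carrier (mod_at V (Dom C f))"
  shows "mod_map V f (\<ominus>\<^bsub>mod_at V (Dom C f)\<^esub> v) = \<ominus>\<^bsub>mod_at V (Cod C f)\<^esub> mod_map V f v"
proof -
  interpret D: left_module "ring_at R (Dom C f)" "mod_at V (Dom C f)"
    by (rule mod_at[OF Dom_closed[OF f]])
  interpret E: left_module "ring_at R (Cod C f)" "mod_at V (Cod C f)"
    by (rule mod_at[OF Cod_closed[OF f]])
  have "mod_map V f (\<ominus>\<^bsub>mod_at V (Dom C f)\<^esub> v) \<oplus>\<^bsub>mod_at V (Cod C f)\<^esub> mod_map V f v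
      = \<zero>\<^bsub>mod_at V (Cod C f)\<^esub>"
    using mod_map_add[OF f D.M.a_inv_closed[OF v] v] v mod_map_zero[OF f] by (simp add: D.M.l_neg)
  then show ?thesis
    using E.M.minus_equality mod_map_closed[OF f] v D.M.a_inv_closed by metis
qed

end

lemma O_hom_zero:
  assumes V: "o_module C R V" and W: "o_module C R W" and h: "\<eta> \<in> O_hom C R V W" and x: "x \<in> Obj C"
  shows "\<eta> x \<zero>\<^bsub>mod_at V x\<^esub> = \<zero>\<^bsub>mod_at W x\<^esub>"
proof -
  interpret D: left_module "ring_at R x" "mod_at V x" by (rule o_module.mod_at[OF V x])
  interpret E: left_module "ring_at R x" "mod_at W x" by (rule o_module.mod_at[OF W x])
  have "\<eta> x \<zero>\<^bsub>mod_at V x\<^esub> \<in> carrier (mod_at W x)"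
    "\<eta> x (\<zero>\<^bsub>mod_at V x\<^esub> \<oplus>\<^bsub>mod_at V x\<^esub> \<zero>\<^bsub>mod_at V x\<^esub>)
      = \<eta> x \<zero>\<^bsub>mod_at V x\<^esub> \<oplus>\<^bsub>mod_at W x\<^esub> \<eta> x \<zero>\<^bsub>mod_at V x\<^esub>"
    using h x D.M.zero_closed unfolding O_hom_def by blast+
  then show ?thesis
    by (metis D.M.zero_closed D.M.l_zero E.M.add.r_cancel_one')
qed

section \<open>Transport of module structure along a congruence\<close>

text \<open>Both quotients and changes of the element type are instances of the following image of
  \<open>V\<close> under a family of maps whose kernels are congruences.\<close>

definition image_module :: "('o \<Rightarrow> 'v \<Rightarrow> 'w) \<Rightarrow> ('o, 'm) cat \<Rightarrow> ('o, 'm, 'r, 'v) omod \<Rightarrow>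
    ('o, 'm, 'r, 'w) omod" where
  "image_module q C V =
    (let r = (\<lambda>x. inv_into (carrier (mod_at V x)) (q x)) in
    \<lparr>mod_at = \<lambda>x. \<lparr>carrier = q x ` carrier (mod_at V x), mult = undefined, one = undefined,
        zero = q x \<zero>\<^bsub>mod_at V x\<^esub>, add = \<lambda>a b. q x (r x a \<oplus>\<^bsub>mod_at V x\<^esub> r x b),
        smult = \<lambda>c a. q x (c \<odot>\<^bsub>mod_at V x\<^esub> r x a)\<rparr>,
     mod_map = \<lambda>f a. q (Cod C f) (mod_map V f (r (Dom C f) a))\<rparr>)"

locale o_module_congruence = o_module C R V
  for C :: "('o, 'm) cat" and R :: "('o, 'm, 'r) rpsh" and V :: "('o, 'm, 'r, 'v) omod" +
  fixes q :: "'o \<Rightarrow> 'v \<Rightarrow> 'w"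
  assumes cong_add: "\<lbrakk>x \<in> Obj C; v \<in> carrier (mod_at V x); v' \<in> carrier (mod_at V x);
      w \<in> carrier (mod_at V x); w' \<in> carrier (mod_at V x); q x v = q x v'; q x w = q x w'\<rbrakk> \<Longrightarrow>
      q x (v \<oplus>\<^bsub>mod_at V x\<^esub> w) = q x (v' \<oplus>\<^bsub>mod_at V x\<^esub> w')"
    and cong_smult: "\<lbrakk>x \<in> Obj C; a \<in> carrier (ring_at R x); v \<in> carrier (mod_at V x);
      v' \<in> carrier (mod_at V x); q x v = q x v'\<rbrakk> \<Longrightarrow>
      q x (a \<odot>\<^bsub>mod_at V x\<^esub> v) = q x (a \<odot>\<^bsub>mod_at V x\<^esub> v')"
    and cong_map: "\<lbrakk>f \<in> Arr C; v \<in> carrier (mod_at V (Dom C f)); v' \<in> carrier (mod_at V (Dom C f));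
      q (Dom C f) v = q (Dom C f) v'\<rbrakk> \<Longrightarrow>
      q (Cod C f) (mod_map V f v) = q (Cod C f) (mod_map V f v')"
begin

text \<open>The representative picked by \<open>inv_into\<close> may differ from \<open>v\<close>
  but has the same value under \<open>q\<close>; the congruence axioms then let \<open>v\<close>
  replace it in every operation of the image.\<close>

lemma rep:
  assumes "v \<in> carrier (mod_at V x)"
  shows "inv_into (carrier (mod_at V x)) (q x) (q x v) \<in> carrier (mod_at V x)"
    and "q x (inv_into (carrier (mod_at V x)) (q x) (q x v)) = q x v"
  using assms by (simp_all add: inv_into_into f_inv_into_f)

lemma image_carrier: "carrier (mod_at (image_module q C V) x) = q x ` carrier (mod_at V x)"
  and image_zero: "\<zero>\<^bsub>mod_at (image_module q C V) x\<^esub> = q x \<zero>\<^bsub>mod_at V x\<^esub>"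
  by (simp_all add: image_module_def Let_def)

lemma image_add:
  assumes "x \<in> Obj C" "v \<in> carrier (mod_at V x)" "w \<in> carrier (mod_at V x)"
  shows "q x v \<oplus>\<^bsub>mod_at (image_module q C V) x\<^esub> q x w = q x (v \<oplus>\<^bsub>mod_at V x\<^esub> w)"
  using cong_add[OF assms(1) rep(1)[OF assms(2)] assms(2) rep(1)[OF assms(3)]
      assms(3) rep(2)[OF assms(2)] rep(2)[OF assms(3)]]
  by (simp add: image_module_def Let_def)

lemma image_smult:
  assumes "x \<in> Obj C" "a \<in> carrier (ring_at R x)" "v \<in> carrier (mod_at V x)"
  shows "a \<odot>\<^bsub>mod_at (image_module q C V) x\<^esub> q x v = q x (a \<odot>\<^bsub>mod_at V x\<^esub> v)"
  using cong_smult[OF assms(1,2) rep(1)[OF assms(3)] assms(3) rep(2)[OF assms(3)]]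
  by (simp add: image_module_def Let_def)

lemma image_map:
  assumes "f \<in> Arr C" "v \<in> carrier (mod_at V (Dom C f))"
  shows "mod_map (image_module q C V) f (q (Dom C f) v) = q (Cod C f) (mod_map V f v)"
  using cong_map[OF assms(1) rep(1)[OF assms(2)] assms(2) rep(2)[OF assms(2)]]
  by (simp add: image_module_def Let_def)

text \<open>Every element of the image has the form \<open>q x v\<close>, so each module law is
  \<open>q\<close> applied to the same law in \<open>V\<close>.\<close>

lemma o_module_image: "o_module C R (image_module q C V)"
proof (intro o_module.intro o_module_axioms.intro)
  show "ring_presheaf C R" by (rule ring_presheaf_axioms)
next
  fix x assume x: "x \<in> Obj C"
  interpret left_module "ring_at R x" "mod_at V x" by (rule mod_at[OF x])
  have "abelian_group (mod_at (image_module q C V) x)"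
  proof (rule abelian_groupI)
    fix a assume "a \<in> carrier (mod_at (image_module q C V) x)"
    then obtain v where v: "v \<in> carrier (mod_at V x)" "a = q x v" by (auto simp: image_carrier)
    then have "q x (\<ominus>\<^bsub>mod_at V x\<^esub> v) \<oplus>\<^bsub>mod_at (image_module q C V) x\<^esub> a
        = \<zero>\<^bsub>mod_at (image_module q C V) x\<^esub>"
      by (simp add: image_add[OF x] image_zero M.l_neg)
    then show "\<exists>b\<in>carrier (mod_at (image_module q C V) x).
        b \<oplus>\<^bsub>mod_at (image_module q C V) x\<^esub> a = \<zero>\<^bsub>mod_at (image_module q C V) x\<^esub>"
      using v by (auto simp: image_carrier)
  qed (auto simp: image_carrier image_zero image_add[OF x] M.a_ac)
  then show "left_module (ring_at R x) (mod_at (image_module q C V) x)"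
    by (rule left_moduleI[OF ring_at[OF x]])
      (auto simp: image_carrier image_add[OF x] image_smult[OF x] smult_closed smult_l_distr
        smult_r_distr smult_assoc1 smult_one)
next
  fix f a v assume f: "f \<in> Arr C" and a: "a \<in> carrier (ring_at R (Dom C f))"
    and v: "v \<in> carrier (mod_at (image_module q C V) (Dom C f))"
  have "ring_map R f a \<in> carrier (ring_at R (Cod C f))"
    using ring_map[OF f] a by (simp add: ring_hom_closed)
  then show "mod_map (image_module q C V) f (a \<odot>\<^bsub>mod_at (image_module q C V) (Dom C f)\<^esub> v)
      = ring_map R f a \<odot>\<^bsub>mod_at (image_module q C V) (Cod C f)\<^esub> mod_map (image_module q C V) f v"
    using f a v left_module.smult_closed[OF mod_at[OF Dom_closed[OF f]]]
    by (auto simp: image_carrier image_smult image_map Dom_closed Cod_closed mod_map_closed mod_map_smult)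
next
  fix f g v assume "f \<in> Arr C" "g \<in> Arr C" "Cod C f = Dom C g"
    and "v \<in> carrier (mod_at (image_module q C V) (Dom C f))"
  then show "mod_map (image_module q C V) (Comp C g f) v
      = mod_map (image_module q C V) g (mod_map (image_module q C V) f v)"
    using image_map[of "Comp C g f"] Comp_arr[of f g] image_map[of g] mod_map_closed[of f]
    by (auto simp: image_carrier image_map mod_map_Comp)
next
  fix f v w assume f: "f \<in> Arr C"
    and v: "v \<in> carrier (mod_at (image_module q C V) (Dom C f))"
    and w: "w \<in> carrier (mod_at (image_module q C V) (Dom C f))"
  interpret left_module "ring_at R (Dom C f)" "mod_at V (Dom C f)" by (rule mod_at[OF Dom_closed[OF f]])
  show "mod_map (image_module q C V) f (v \<oplus>\<^bsub>mod_at (image_module q C V) (Dom C f)\<^esub> w)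
     = mod_map (image_module q C V) f v \<oplus>\<^bsub>mod_at (image_module q C V) (Cod C f)\<^esub>
       mod_map (image_module q C V) f w"
    using f v w
    by (auto simp: image_carrier image_add image_map Dom_closed Cod_closed mod_map_closed mod_map_add)
next
  fix x v assume "x \<in> Obj C" "v \<in> carrier (mod_at (image_module q C V) x)"
  then show "mod_map (image_module q C V) (Ident C x) v = v"
    using image_map[of "Ident C x"] Ident_arr[of x] by (auto simp: image_carrier mod_map_Ident)
qed (auto simp: image_carrier image_map mod_map_closed)

end

section \<open>Submodules and quotients\<close>

context o_module
begin

lemma o_module_restrict:
  assumes U: "o_submodule C R U V"
  shows "o_module C R (restrict_module V U)"
proof -
  have sub: "submodule (U x) (ring_at R x) (mod_at V x)" if "x \<in> Obj C" for x
    using U that by (simp add: o_submodule_def)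
  then have U_carrier: "v \<in> carrier (mod_at V x)" if "x \<in> Obj C" "v \<in> U x" for x v
    using subgroup.subset[OF submodule.axioms(1)[OF sub[OF that(1)]]] that(2) by auto
  show ?thesis
  proof (intro o_module.intro o_module_axioms.intro)
    show "ring_presheaf C R" by (rule ring_presheaf_axioms)
  next
    fix x assume x: "x \<in> Obj C"
    interpret left_module "ring_at R x" "mod_at V x" by (rule mod_at[OF x])
    interpret S: submodule "U x" "ring_at R x" "mod_at V x" by (rule sub[OF x])
    \<comment> \<open>A submodule is a subgroup of \<open>add_monoid\<close>, whose unit and product
      are the zero and the sum of the module.\<close>
    have S_closed: "\<zero>\<^bsub>mod_at V x\<^esub> \<in> U x"
      "\<And>v w. \<lbrakk>v \<in> U x; w \<in> U x\<rbrakk> \<Longrightarrow> v \<oplus>\<^bsub>mod_at V x\<^esub> w \<in> U x"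
      using S.one_closed S.m_closed by simp_all
    have "abelian_group (mod_at (restrict_module V U) x)"
    proof (rule abelian_groupI)
      fix v assume "v \<in> carrier (mod_at (restrict_module V U) x)"
      then have "v \<in> U x" by (simp add: restrict_module_def)
      then have "\<ominus>\<^bsub>mod_at V x\<^esub> v \<in> U x" "\<ominus>\<^bsub>mod_at V x\<^esub> v \<oplus>\<^bsub>mod_at V x\<^esub> v = \<zero>\<^bsub>mod_at V x\<^esub>"
        using S.m_inv_closed[of v] U_carrier[OF x] by (auto simp: a_inv_def[symmetric] M.l_neg)
      then show "\<exists>w\<in>carrier (mod_at (restrict_module V U) x).
          w \<oplus>\<^bsub>mod_at (restrict_module V U) x\<^esub> v = \<zero>\<^bsub>mod_at (restrict_module V U) x\<^esub>"
        by (auto simp: restrict_module_def)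
    qed (simp_all add: restrict_module_def S_closed U_carrier[OF x] M.a_ac)
    then show "left_module (ring_at R x) (mod_at (restrict_module V U) x)"
      by (rule left_moduleI[OF ring_at[OF x]])
        (use U_carrier[OF x] in \<open>auto simp: restrict_module_def smult_l_distr
          smult_r_distr smult_assoc1 smult_one\<close>)
  qed (use U U_carrier Dom_closed in \<open>auto simp: restrict_module_def o_submodule_def
      mod_map_add mod_map_smult mod_map_Ident mod_map_Comp\<close>)
qed

text \<open>The quotient has to live on the same element type, so it is carried by
  chosen representatives of the cosets.\<close>

lemma short_exact_quotient:
  assumes U: "o_submodule C R U V"
  shows "\<exists>B \<beta>. o_module C R B \<and> short_exact C R (restrict_module V U) (\<lambda>x v. v) V \<beta> B"
proof -
  define q where "q x v = (SOME w. w \<in> U x +>\<^bsub>mod_at V x\<^esub> v)" for x v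
  have sub: "submodule (U x) (ring_at R x) (mod_at V x)" if "x \<in> Obj C" for x
    using U that by (simp add: o_submodule_def)
  have subgr: "subgroup (U x) (add_monoid (mod_at V x))" if "x \<in> Obj C" for x
    using submodule.axioms(1)[OF sub[OF that]] .
  have U_carrier: "v \<in> carrier (mod_at V x)" if "x \<in> Obj C" "v \<in> U x" for x v
    using subgroup.subset[OF subgr[OF that(1)]] that(2) by auto
  have q_iff: "q x v = q x w \<longleftrightarrow> (\<exists>u\<in>U x. v = u \<oplus>\<^bsub>mod_at V x\<^esub> w)"
    if x: "x \<in> Obj C" and v: "v \<in> carrier (mod_at V x)" and w: "w \<in> carrier (mod_at V x)" for x v w
  proof -
    interpret left_module "ring_at R x" "mod_at V x" by (rule mod_at[OF x])
    have rcos_self: "v \<in> U x +>\<^bsub>mod_at V x\<^esub> v" if "v \<in> carrier (mod_at V x)" for v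
      using that subgroup.one_closed[OF subgr[OF x]] by (force simp: a_r_coset_def')
    have self: "q x v \<in> U x +>\<^bsub>mod_at V x\<^esub> v" if "v \<in> carrier (mod_at V x)" for v
      unfolding q_def using rcos_self[OF that] by (rule someI)
    \<comment> \<open>The representative lies in its own coset and therefore determines it;
      conversely, it was chosen from the coset alone.\<close>
    have "q x v = q x w \<longleftrightarrow> U x +>\<^bsub>mod_at V x\<^esub> v = U x +>\<^bsub>mod_at V x\<^esub> w"
      using M.a_repr_independence[OF self v subgr[OF x]] M.a_repr_independence[OF self w subgr[OF x]] v w
      by (metis q_def)
    also have "\<dots> \<longleftrightarrow> v \<in> U x +>\<^bsub>mod_at V x\<^esub> w"
      using M.a_repr_independence[OF _ w subgr[OF x]] rcos_self[OF v] by blast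
    finally show ?thesis by (auto simp: a_r_coset_def')
  qed
  \<comment> \<open>By \<open>q_iff\<close>, equal values differ by an element of \<open>U\<close>.
    The three conditions thus amount to closure of \<open>U\<close> under sums, scalars and
    structure maps.\<close>
  interpret o_module_congruence C R V q
  proof
    fix x v v' w w'
    assume x: "x \<in> Obj C" and c: "v \<in> carrier (mod_at V x)" "v' \<in> carrier (mod_at V x)"
      "w \<in> carrier (mod_at V x)" "w' \<in> carrier (mod_at V x)"
      and e: "q x v = q x v'" "q x w = q x w'"
    interpret left_module "ring_at R x" "mod_at V x" by (rule mod_at[OF x])
    obtain u1 u2 where u: "u1 \<in> U x" "u2 \<in> U x" and
      vw: "v = u1 \<oplus>\<^bsub>mod_at V x\<^esub> v'" "w = u2 \<oplus>\<^bsub>mod_at V x\<^esub> w'"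
      using e unfolding q_iff[OF x c(1,2)] q_iff[OF x c(3,4)] by blast
    have "u1 \<oplus>\<^bsub>mod_at V x\<^esub> u2 \<in> U x"
      using subgroup.m_closed[OF subgr[OF x]] u by simp
    moreover have "v \<oplus>\<^bsub>mod_at V x\<^esub> w = (u1 \<oplus>\<^bsub>mod_at V x\<^esub> u2) \<oplus>\<^bsub>mod_at V x\<^esub> (v' \<oplus>\<^bsub>mod_at V x\<^esub> w')"
      using c u U_carrier[OF x] by (simp add: vw M.a_ac)
    ultimately show "q x (v \<oplus>\<^bsub>mod_at V x\<^esub> w) = q x (v' \<oplus>\<^bsub>mod_at V x\<^esub> w')"
      using q_iff[OF x M.a_closed[OF c(1,3)] M.a_closed[OF c(2,4)]] by blast
  next
    fix x a v v'
    assume x: "x \<in> Obj C" and a: "a \<in> carrier (ring_at R x)"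
      and c: "v \<in> carrier (mod_at V x)" "v' \<in> carrier (mod_at V x)" and e: "q x v = q x v'"
    interpret left_module "ring_at R x" "mod_at V x" by (rule mod_at[OF x])
    obtain u where u: "u \<in> U x" "v = u \<oplus>\<^bsub>mod_at V x\<^esub> v'" using e unfolding q_iff[OF x c] by blast
    then have "a \<odot>\<^bsub>mod_at V x\<^esub> u \<in> U x"
      "a \<odot>\<^bsub>mod_at V x\<^esub> v = a \<odot>\<^bsub>mod_at V x\<^esub> u \<oplus>\<^bsub>mod_at V x\<^esub> a \<odot>\<^bsub>mod_at V x\<^esub> v'"
      using a c U_carrier[OF x] submodule.smult_closed[OF sub[OF x]] by (auto simp: smult_r_distr)
    then show "q x (a \<odot>\<^bsub>mod_at V x\<^esub> v) = q x (a \<odot>\<^bsub>mod_at V x\<^esub> v')"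
      using q_iff[OF x smult_closed[OF a c(1)] smult_closed[OF a c(2)]] by blast
  next
    fix f v v'
    assume f: "f \<in> Arr C" and c: "v \<in> carrier (mod_at V (Dom C f))" "v' \<in> carrier (mod_at V (Dom C f))"
      and e: "q (Dom C f) v = q (Dom C f) v'"
    obtain u where u: "u \<in> U (Dom C f)" "v = u \<oplus>\<^bsub>mod_at V (Dom C f)\<^esub> v'"
      using e unfolding q_iff[OF Dom_closed[OF f] c] by blast
    then have "mod_map V f u \<in> U (Cod C f)"
      "mod_map V f v = mod_map V f u \<oplus>\<^bsub>mod_at V (Cod C f)\<^esub> mod_map V f v'"
      using f c U U_carrier[OF Dom_closed[OF f]] by (auto simp: mod_map_add o_submodule_def)
    then show "q (Cod C f) (mod_map V f v) = q (Cod C f) (mod_map V f v')"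
      using q_iff[OF Cod_closed[OF f] mod_map_closed[OF f c(1)] mod_map_closed[OF f c(2)]] by blast
  qed
  have "short_exact C R (restrict_module V U) (\<lambda>x v. v) V q (image_module q C V)"
    unfolding short_exact_def
  proof (intro conjI ballI)
    show "(\<lambda>x v. v) \<in> O_hom C R (restrict_module V U) V"
      using U_carrier by (auto simp: O_hom_def restrict_module_def)
    show "q \<in> O_hom C R V (image_module q C V)"
      by (auto simp: O_hom_def image_carrier image_add image_smult image_map)
  next
    fix x assume x: "x \<in> Obj C"
    interpret left_module "ring_at R x" "mod_at V x" by (rule mod_at[OF x])
    \<comment> \<open>The kernel of \<open>q\<close> is read off from \<open>q_iff\<close> with zero
      as the second element.\<close>
    show "(\<lambda>v. v) ` carrier (mod_at (restrict_module V U) x)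
        = {v \<in> carrier (mod_at V x). q x v = \<zero>\<^bsub>mod_at (image_module q C V) x\<^esub>}"
      using q_iff[OF x _ M.zero_closed] U_carrier[OF x]
      by (auto simp: restrict_module_def image_zero)
  qed (auto simp: image_carrier)
  then show ?thesis using o_module_image by blast
qed

end

section \<open>The torsion submodule of a directed rule\<close>

text \<open>Common ground of the two implications: a Grothendieck topology has these properties, and
  the converse assumes them. They allow torsion to be tested by a single member of
  \<open>J x\<close> instead of a finite sum.\<close>

locale directed_rule = category C
  for C :: "('o, 'm) cat" +
  fixes J :: "'o \<Rightarrow> 'm set set"
  assumes rule: "is_rule C J"
    and stable: "stability_axiom C J"
    and nonempty: "x \<in> Obj C \<Longrightarrow> J x \<noteq> {}"
    and Int_closed: "\<lbrakk>x \<in> Obj C; S \<in> J x; T \<in> J x\<rbrakk> \<Longrightarrow> S \<inter> T \<in> J x"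
begin

lemma J_subfunctor: "\<lbrakk>x \<in> Obj C; S \<in> J x\<rbrakk> \<Longrightarrow> subfunctor C x S"
  using rule by (simp add: is_rule_def)

lemma J_arr: "\<lbrakk>x \<in> Obj C; S \<in> J x; f \<in> S\<rbrakk> \<Longrightarrow> f \<in> Arr C \<and> Dom C f = x"
  using J_subfunctor subfunctor_subset by blast

lemma J_pullback: "\<lbrakk>f \<in> Arr C; S \<in> J (Dom C f)\<rbrakk> \<Longrightarrow> pullback C f S \<in> J (Cod C f)"
  using stable Dom_closed by (auto simp: stability_axiom_def representable_def)

text \<open>If \<open>S\<close> kills one summand and \<open>T\<close> kills the other, then
  \<open>S \<inter> T\<close> kills the sum and is again in \<open>J x\<close>. Induction over the
  finite sum leaves one annihilating member.\<close>

lemma torsion_part_eq: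
  assumes V: "o_module C R V" and x: "x \<in> Obj C"
  shows "torsion_part C J V x = (\<Union>S\<in>J x. annihilated_part C V x S)"
proof
  interpret o_module C R V by (rule V)
  interpret left_module "ring_at R x" "mod_at V x" by (rule mod_at[OF x])
  show "(\<Union>S\<in>J x. annihilated_part C V x S) \<subseteq> torsion_part C J V x"
  proof
    fix v assume "v \<in> (\<Union>S\<in>J x. annihilated_part C V x S)"
    then obtain S where S: "S \<in> J x" "v \<in> annihilated_part C V x S" by blast
    then have "finsum (mod_at V x) (\<lambda>_. v) {S} = v"
      using M.finsum_insert[of "{}" S "\<lambda>_. v"] by (simp add: annihilated_part_def)
    then show "v \<in> torsion_part C J V x"
      unfolding torsion_part_def using S by (auto intro!: exI[of _ "\<lambda>_. v"] exI[of _ "{S}"])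
  qed
  have zero_killed: "mod_map V f \<zero>\<^bsub>mod_at V x\<^esub> = \<zero>\<^bsub>mod_at V (Cod C f)\<^esub>" if "S \<in> J x" "f \<in> S" for S f
    using mod_map_zero J_arr[OF x that] by auto
  have "\<exists>S\<in>J x. finsum (mod_at V x) t F \<in> annihilated_part C V x S"
    if "finite F" "F \<subseteq> J x" "\<forall>S\<in>F. t S \<in> annihilated_part C V x S" for t F
    using that
  proof (induction F rule: finite_induct)
    case empty
    then show ?case
      \<comment> \<open>The empty sum is zero, which any member of \<open>J x\<close> kills; some
        member must exist.\<close>
      using nonempty[OF x] zero_killed by (auto simp: annihilated_part_def)
  next
    case (insert S F)
    then obtain T where T: "T \<in> J x" "finsum (mod_at V x) t F \<in> annihilated_part C V x T" by auto
    have S: "S \<in> J x" "t S \<in> annihilated_part C V x S" using insert by auto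
    have "t \<in> F \<rightarrow> carrier (mod_at V x)"
      using insert.prems by (auto simp: annihilated_part_def)
    then have "finsum (mod_at V x) t (insert S F) = t S \<oplus>\<^bsub>mod_at V x\<^esub> finsum (mod_at V x) t F"
      using insert S by (intro M.finsum_insert) (auto simp: annihilated_part_def)
    moreover have "\<dots> \<in> annihilated_part C V x (S \<inter> T)"
    proof -
      have "mod_map V f (t S \<oplus>\<^bsub>mod_at V x\<^esub> finsum (mod_at V x) t F) = \<zero>\<^bsub>mod_at V (Cod C f)\<^esub>"
        if "f \<in> S \<inter> T" for f
      proof -
        have f: "f \<in> Arr C" "Dom C f = x" using that J_arr[OF x S(1)] by auto
        interpret E: left_module "ring_at R (Cod C f)" "mod_at V (Cod C f)"
          by (rule mod_at[OF Cod_closed[OF f(1)]])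
        show ?thesis
          using that S T f mod_map_add[of f] by (auto simp: annihilated_part_def)
      qed
      then show ?thesis using S T by (auto simp: annihilated_part_def)
    qed
    ultimately show ?case using Int_closed[OF x S(1) T(1)] by metis
  qed
  then show "torsion_part C J V x \<subseteq> (\<Union>S\<in>J x. annihilated_part C V x S)"
    unfolding torsion_part_def by blast
qed

lemma torsion_part_iff:
  assumes V: "o_module C R V" and x: "x \<in> Obj C"
  shows "v \<in> torsion_part C J V x \<longleftrightarrow> v \<in> carrier (mod_at V x) \<and>
    (\<exists>S\<in>J x. \<forall>f\<in>S. mod_map V f v = \<zero>\<^bsub>mod_at V (Cod C f)\<^esub>)"
  using torsion_part_eq[OF assms] by (auto simp: annihilated_part_def)

lemma torsion_class_iff:
  "V \<in> torsion_class C R J \<longleftrightarrow> o_module C R V \<and> (\<forall>x\<in>Obj C. \<forall>v\<in>carrier (mod_at V x).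
     \<exists>S\<in>J x. \<forall>f\<in>S. mod_map V f v = \<zero>\<^bsub>mod_at V (Cod C f)\<^esub>)"
proof (cases "o_module C R V")
  case True
  then show ?thesis
    by (auto simp: torsion_class_def O_Mod_def set_eq_iff torsion_part_iff[OF True])
qed (simp add: torsion_class_def O_Mod_def)

lemma torsion_free_class_iff:
  "V \<in> torsion_free_class C R J \<longleftrightarrow> o_module C R V \<and> (\<forall>x\<in>Obj C. \<forall>v\<in>carrier (mod_at V x).
     (\<exists>S\<in>J x. \<forall>f\<in>S. mod_map V f v = \<zero>\<^bsub>mod_at V (Cod C f)\<^esub>) \<longrightarrow> v = \<zero>\<^bsub>mod_at V x\<^esub>)"
proof (cases "o_module C R V")
  case True
  then interpret o_module C R V .
  \<comment> \<open>Since zero is always in the torsion part, equality with the zero submodule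
    reduces to one inclusion.\<close>
  have "\<zero>\<^bsub>mod_at V x\<^esub> \<in> torsion_part C J V x" if x: "x \<in> Obj C" for x
  proof -
    interpret left_module "ring_at R x" "mod_at V x" by (rule mod_at[OF x])
    obtain S where S: "S \<in> J x" using nonempty[OF x] by blast
    have "mod_map V f \<zero>\<^bsub>mod_at V x\<^esub> = \<zero>\<^bsub>mod_at V (Cod C f)\<^esub>" if "f \<in> S" for f
      using mod_map_zero J_arr[OF x S that] by auto
    then show ?thesis using S by (auto simp: torsion_part_iff[OF True x])
  qed
  then have "torsion_part C J V x = {\<zero>\<^bsub>mod_at V x\<^esub>} \<longleftrightarrow>
      (\<forall>v. v \<in> torsion_part C J V x \<longrightarrow> v = \<zero>\<^bsub>mod_at V x\<^esub>)" if "x \<in> Obj C" for x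
    using that by blast
  then show ?thesis
    using True by (simp add: torsion_free_class_def O_Mod_def torsion_part_iff[OF True] Ball_def) blast
qed (simp add: torsion_free_class_def O_Mod_def)

text \<open>Intersections handle sums, and the same \<open>S\<close> handles negatives and scalar
  multiples, because structure maps are semilinear over \<open>ring_map\<close>. If \<open>S\<close>
  kills \<open>v\<close>, then \<open>pullback C f S\<close> kills the image of \<open>v\<close>
  along \<open>f\<close>; stability makes this pullback a member of the rule.\<close>

lemma o_submodule_torsion_part:
  assumes V: "o_module C R V"
  shows "o_submodule C R (torsion_part C J V) V"
  unfolding o_submodule_def
proof (intro conjI ballI)
  interpret o_module C R V by (rule V)
  fix x assume x: "x \<in> Obj C"
  interpret left_module "ring_at R x" "mod_at V x" by (rule mod_at[OF x])
  note iff = torsion_part_iff[OF V x]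
  show "submodule (torsion_part C J V x) (ring_at R x) (mod_at V x)"
  proof (intro submodule.intro subgroup.intro submodule_axioms.intro)
    show "torsion_part C J V x \<subseteq> carrier (add_monoid (mod_at V x))" by (auto simp: iff)
    obtain S where S: "S \<in> J x" using nonempty[OF x] by blast
    have "mod_map V f \<zero>\<^bsub>mod_at V x\<^esub> = \<zero>\<^bsub>mod_at V (Cod C f)\<^esub>" if "f \<in> S" for f
      using mod_map_zero J_arr[OF x S that] by auto
    then show "\<one>\<^bsub>add_monoid (mod_at V x)\<^esub> \<in> torsion_part C J V x"
      using S by (auto simp: iff)
  next
    fix v w assume "v \<in> torsion_part C J V x" "w \<in> torsion_part C J V x"
    then obtain S T where S: "v \<in> carrier (mod_at V x)" "S \<in> J x"
        "\<forall>f\<in>S. mod_map V f v = \<zero>\<^bsub>mod_at V (Cod C f)\<^esub>"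
      and T: "w \<in> carrier (mod_at V x)" "T \<in> J x" "\<forall>f\<in>T. mod_map V f w = \<zero>\<^bsub>mod_at V (Cod C f)\<^esub>"
      by (auto simp: iff)
    have "mod_map V f (v \<oplus>\<^bsub>mod_at V x\<^esub> w) = \<zero>\<^bsub>mod_at V (Cod C f)\<^esub>" if "f \<in> S \<inter> T" for f
    proof -
      have f: "f \<in> Arr C" "Dom C f = x" using that J_arr[OF x S(2)] by auto
      interpret E: left_module "ring_at R (Cod C f)" "mod_at V (Cod C f)"
        by (rule mod_at[OF Cod_closed[OF f(1)]])
      show ?thesis using that S T f mod_map_add[of f] by auto
    qed
    then have "\<exists>S'\<in>J x. \<forall>f\<in>S'. mod_map V f (v \<oplus>\<^bsub>mod_at V x\<^esub> w) = \<zero>\<^bsub>mod_at V (Cod C f)\<^esub>"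
      using Int_closed[OF x S(2) T(2)] by blast
    then show "v \<otimes>\<^bsub>add_monoid (mod_at V x)\<^esub> w \<in> torsion_part C J V x"
      using S(1) T(1) by (simp add: iff)
  next
    fix v assume "v \<in> torsion_part C J V x"
    then obtain S where S: "v \<in> carrier (mod_at V x)" "S \<in> J x"
        "\<forall>f\<in>S. mod_map V f v = \<zero>\<^bsub>mod_at V (Cod C f)\<^esub>"
      by (auto simp: iff)
    have "mod_map V f (\<ominus>\<^bsub>mod_at V x\<^esub> v) = \<zero>\<^bsub>mod_at V (Cod C f)\<^esub>" if "f \<in> S" for f
    proof -
      have f: "f \<in> Arr C" "Dom C f = x" using that J_arr[OF x S(2)] by auto
      interpret E: left_module "ring_at R (Cod C f)" "mod_at V (Cod C f)"
        by (rule mod_at[OF Cod_closed[OF f(1)]])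
      show ?thesis using that S f mod_map_minus[of f] by auto
    qed
    then show "inv\<^bsub>add_monoid (mod_at V x)\<^esub> v \<in> torsion_part C J V x"
      using S by (auto simp: iff a_inv_def[symmetric])
  next
    fix a v assume a: "a \<in> carrier (ring_at R x)" and "v \<in> torsion_part C J V x"
    then obtain S where S: "v \<in> carrier (mod_at V x)" "S \<in> J x"
        "\<forall>f\<in>S. mod_map V f v = \<zero>\<^bsub>mod_at V (Cod C f)\<^esub>"
      by (auto simp: iff)
    have "mod_map V f (a \<odot>\<^bsub>mod_at V x\<^esub> v) = \<zero>\<^bsub>mod_at V (Cod C f)\<^esub>" if "f \<in> S" for f
    proof -
      have f: "f \<in> Arr C" "Dom C f = x" using that J_arr[OF x S(2)] by auto
      interpret E: left_module "ring_at R (Cod C f)" "mod_at V (Cod C f)"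
        by (rule mod_at[OF Cod_closed[OF f(1)]])
      have "ring_map R f a \<in> carrier (ring_at R (Cod C f))"
        using ring_hom_closed[OF ring_map[OF f(1)]] a f by simp
      then show ?thesis using that a S f mod_map_smult[of f] by (auto simp: E.smult_r_null)
    qed
    then show "a \<odot>\<^bsub>mod_at V x\<^esub> v \<in> torsion_part C J V x"
      using a S by (auto simp: iff smult_closed)
  qed
next
  interpret o_module C R V by (rule V)
  fix f v assume f: "f \<in> Arr C" and v: "v \<in> torsion_part C J V (Dom C f)"
  then obtain S where S: "v \<in> carrier (mod_at V (Dom C f))" "S \<in> J (Dom C f)"
      "\<forall>g\<in>S. mod_map V g v = \<zero>\<^bsub>mod_at V (Cod C g)\<^esub>"
    by (auto simp: torsion_part_iff[OF V Dom_closed])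
  have "mod_map V g (mod_map V f v) = \<zero>\<^bsub>mod_at V (Cod C g)\<^esub>" if "g \<in> pullback C f S" for g
  proof -
    have g: "g \<in> Arr C" "Dom C g = Cod C f" "Comp C g f \<in> S"
      using that by (auto simp: pullback_def representable_def)
    then show ?thesis
      using S(3) mod_map_Comp[OF f g(1) _ S(1)] Comp_arr[OF f g(1)] by simp
  qed
  then show "mod_map V f v \<in> torsion_part C J V (Cod C f)"
    using S f J_pullback[OF f S(2)] mod_map_closed by (auto simp: torsion_part_iff[OF V Cod_closed])
qed

section \<open>Closure properties of the torsion and torsion-free classes\<close>

text \<open>By naturality, an \<open>S\<close> killing \<open>v\<close> kills
  \<open>\<eta> x v\<close>, and surjectivity gives every element of \<open>W\<close> this
  form.\<close>

lemma replete_torsion_class: "replete C R (torsion_class C R J)"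
  unfolding replete_def
proof (intro ballI impI)
  fix V W assume "V \<in> torsion_class C R J" "W \<in> O_Mod C R" "isomorphic_modules C R V W"
  then obtain \<eta> where V: "o_module C R V" and W: "o_module C R W" and h: "\<eta> \<in> O_hom C R V W"
    and bij: "\<And>x. x \<in> Obj C \<Longrightarrow> bij_betw (\<eta> x) (carrier (mod_at V x)) (carrier (mod_at W x))"
    and tors: "\<And>x v. \<lbrakk>x \<in> Obj C; v \<in> carrier (mod_at V x)\<rbrakk> \<Longrightarrow>
      \<exists>S\<in>J x. \<forall>f\<in>S. mod_map V f v = \<zero>\<^bsub>mod_at V (Cod C f)\<^esub>"
    by (auto simp: isomorphic_modules_def torsion_class_iff O_Mod_def)
  have "\<exists>S\<in>J x. \<forall>f\<in>S. mod_map W f w = \<zero>\<^bsub>mod_at W (Cod C f)\<^esub>"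
    if x: "x \<in> Obj C" and w: "w \<in> carrier (mod_at W x)" for x w
  proof -
    obtain v where v: "v \<in> carrier (mod_at V x)" "w = \<eta> x v"
      using bij[OF x] w by (auto simp: bij_betw_def)
    obtain S where S: "S \<in> J x" "\<forall>f\<in>S. mod_map V f v = \<zero>\<^bsub>mod_at V (Cod C f)\<^esub>"
      using tors[OF x v(1)] by blast
    have "mod_map W f w = \<zero>\<^bsub>mod_at W (Cod C f)\<^esub>" if f: "f \<in> S" for f
      using h v S f J_arr[OF x S(1) f] O_hom_zero[OF V W h Cod_closed[of f]]
      by (auto simp: O_hom_def) metis
    then show ?thesis using S by blast
  qed
  then show "W \<in> torsion_class C R J" using W by (auto simp: torsion_class_iff)
qed

text \<open>Injectivity of \<open>\<eta>\<close> at the codomains reflects vanishing: an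
  \<open>S\<close> killing \<open>w\<close> also kills its preimage, which is then zero.\<close>

lemma replete_torsion_free_class: "replete C R (torsion_free_class C R J)"
  unfolding replete_def
proof (intro ballI impI)
  fix V W assume "V \<in> torsion_free_class C R J" "W \<in> O_Mod C R" "isomorphic_modules C R V W"
  then obtain \<eta> where V: "o_module C R V" and W: "o_module C R W" and h: "\<eta> \<in> O_hom C R V W"
    and bij: "\<And>x. x \<in> Obj C \<Longrightarrow> bij_betw (\<eta> x) (carrier (mod_at V x)) (carrier (mod_at W x))"
    and free: "\<And>x v S. \<lbrakk>x \<in> Obj C; v \<in> carrier (mod_at V x); S \<in> J x;
      \<forall>f\<in>S. mod_map V f v = \<zero>\<^bsub>mod_at V (Cod C f)\<^esub>\<rbrakk> \<Longrightarrow> v = \<zero>\<^bsub>mod_at V x\<^esub>"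
    by (fastforce simp: isomorphic_modules_def torsion_free_class_iff O_Mod_def)
  interpret V: o_module C R V by (rule V)
  have "w = \<zero>\<^bsub>mod_at W x\<^esub>"
    if x: "x \<in> Obj C" and w: "w \<in> carrier (mod_at W x)" and S: "S \<in> J x"
      and 0: "\<forall>f\<in>S. mod_map W f w = \<zero>\<^bsub>mod_at W (Cod C f)\<^esub>" for x w S
  proof -
    obtain v where v: "v \<in> carrier (mod_at V x)" "w = \<eta> x v"
      using bij[OF x] w by (auto simp: bij_betw_def)
    have "mod_map V f v = \<zero>\<^bsub>mod_at V (Cod C f)\<^esub>" if f: "f \<in> S" for f
    proof -
      have a: "f \<in> Arr C" "Dom C f = x" using J_arr[OF x S f] by auto
      interpret E: left_module "ring_at R (Cod C f)" "mod_at V (Cod C f)"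
        by (rule V.mod_at[OF Cod_closed[OF a(1)]])
      have "\<eta> (Cod C f) (mod_map V f v) = mod_map W f w"
        using h v a by (auto simp: O_hom_def)
      also have "\<dots> = \<eta> (Cod C f) \<zero>\<^bsub>mod_at V (Cod C f)\<^esub>"
        using 0 f O_hom_zero[OF V W h Cod_closed[OF a(1)]] by simp
      finally show ?thesis
        using bij[OF Cod_closed[OF a(1)]] V.mod_map_closed[OF a(1)] v a
        by (auto simp: bij_betw_def inj_on_def)
    qed
    then show ?thesis using free[OF x v(1) S] v O_hom_zero[OF V W h x] by simp
  qed
  then show "W \<in> torsion_free_class C R J" using W by (auto simp: torsion_free_class_iff)
qed

text \<open>Naturality makes the image of \<open>v\<close> vanish along the same \<open>S\<close>
  that kills \<open>v\<close>, so the image is a torsion element of a torsion-free module.\<close>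

lemma torsion_to_torsion_free_zero:
  assumes V: "V \<in> torsion_class C R J" and W: "W \<in> torsion_free_class C R J"
    and h: "\<eta> \<in> O_hom C R V W"
  shows "zero_hom C V W \<eta>"
  unfolding zero_hom_def
proof (intro ballI)
  fix x v assume x: "x \<in> Obj C" and v: "v \<in> carrier (mod_at V x)"
  have VW: "o_module C R V" "o_module C R W"
    using V W by (auto simp: torsion_class_iff torsion_free_class_iff)
  obtain S where S: "S \<in> J x" "\<forall>f\<in>S. mod_map V f v = \<zero>\<^bsub>mod_at V (Cod C f)\<^esub>"
    using V x v torsion_class_iff[of V] by blast
  have "mod_map W f (\<eta> x v) = \<zero>\<^bsub>mod_at W (Cod C f)\<^esub>" if f: "f \<in> S" for f
    using h v S f J_arr[OF x S(1) f] O_hom_zero[OF VW h Cod_closed[of f]]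
    by (auto simp: O_hom_def) metis
  moreover have "\<eta> x v \<in> carrier (mod_at W x)" using h x v by (auto simp: O_hom_def)
  ultimately show "\<eta> x v = \<zero>\<^bsub>mod_at W x\<^esub>"
    using W x S(1) torsion_free_class_iff[of W] by blast
qed

text \<open>Restriction keeps the structure maps and the zeros, so the \<open>S\<close> that killed
  an element in \<open>V\<close> still kills it.\<close>

lemma torsion_class_restrict:
  assumes V: "V \<in> torsion_class C R J" and U: "o_submodule C R U V"
  shows "restrict_module V U \<in> torsion_class C R J"
proof -
  interpret o_module C R V using V by (simp add: torsion_class_iff)
  have "submodule (U x) (ring_at R x) (mod_at V x)" if "x \<in> Obj C" for x
    using U that by (simp add: o_submodule_def)
  then have "v \<in> carrier (mod_at V x)" if "x \<in> Obj C" "v \<in> U x" for x v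
    using subgroup.subset[OF submodule.axioms(1)] that by fastforce
  then show ?thesis
    using V o_module_restrict[OF U] by (auto simp: torsion_class_iff restrict_module_def)
qed

lemma restrict_torsion_part:
  assumes V: "o_module C R V"
  shows "restrict_module V (torsion_part C J V) \<in> torsion_class C R J"
  using o_module.o_module_restrict[OF V o_submodule_torsion_part[OF V]] torsion_part_iff[OF V]
  by (auto simp: torsion_class_iff restrict_module_def)

end

section \<open>From Grothendieck topologies to hereditary torsion pairs\<close>

lemma (in category) grothendieck_directed_rule:
  assumes "grothendieck_topology C J"
  shows "directed_rule C J"
  using assms grothendieck_Int[OF assms]
  by unfold_locales (auto simp: grothendieck_topology_def maximal_axiom_def)

lemma (in ring_presheaf) grothendieck_hereditary:
  fixes J :: "'o \<Rightarrow> 'm set set"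
  assumes J: "grothendieck_topology C J"
  shows "hereditary_torsion_pair C R
    (torsion_class C R J :: ('o, 'm, 'r, 'v) omod set) (torsion_free_class C R J)"
proof -
  interpret directed_rule C J by (rule grothendieck_directed_rule[OF J])
  \<comment> \<open>\<open>A\<close> is the torsion submodule of \<open>V\<close> and
    \<open>B\<close> the quotient by it. Torsion-freeness of \<open>B\<close> is where transitivity
    enters.\<close>
  have "\<exists>A\<in>torsion_class C R J. \<exists>B\<in>torsion_free_class C R J. \<exists>\<alpha> \<beta>. short_exact C R A \<alpha> V \<beta> B"
    if V: "o_module C R V" for V :: "('o, 'm, 'r, 'v) omod"
  proof -
    interpret V: o_module C R V by (rule V)
    obtain B \<beta> where B: "o_module C R B"
      and ex: "short_exact C R (restrict_module V (torsion_part C J V)) (\<lambda>x v. v) V \<beta> B"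
      using V.short_exact_quotient[OF o_submodule_torsion_part[OF V]] by blast
    have h: "\<beta> \<in> O_hom C R V B" using ex by (simp add: short_exact_def)
    have ker: "v \<in> torsion_part C J V x \<longleftrightarrow> v \<in> carrier (mod_at V x) \<and> \<beta> x v = \<zero>\<^bsub>mod_at B x\<^esub>"
      and sur: "\<beta> x ` carrier (mod_at V x) = carrier (mod_at B x)" if "x \<in> Obj C" for x v
      using ex that by (auto simp: short_exact_def restrict_module_def)
    have "b = \<zero>\<^bsub>mod_at B x\<^esub>"
      if x: "x \<in> Obj C" and b: "b \<in> carrier (mod_at B x)" and S: "S \<in> J x"
        and 0: "\<forall>f\<in>S. mod_map B f b = \<zero>\<^bsub>mod_at B (Cod C f)\<^esub>" for x b S
    proof -
      obtain v where v: "v \<in> carrier (mod_at V x)" "b = \<beta> x v" using b sur[OF x] by blast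
      \<comment> \<open>\<open>T\<close> is the annihilator of a lift \<open>v\<close> of
        \<open>b\<close>. Once \<open>T\<close> is known to be covering, \<open>v\<close> is torsion
        and \<open>b\<close> vanishes.\<close>
      define T where "T = {f \<in> representable C x. mod_map V f v = \<zero>\<^bsub>mod_at V (Cod C f)\<^esub>}"
      have T: "subfunctor C x T"
        unfolding subfunctor_def T_def
        using v Comp_arr V.mod_map_Comp V.mod_map_zero by (auto simp: representable_def) metis
      have "pullback C f T \<in> J (Cod C f)" if f: "f \<in> S" for f
      proof -
        have a: "f \<in> Arr C" "Dom C f = x" using J_arr[OF x S f] by auto
        have y: "Cod C f \<in> Obj C" using Cod_closed[OF a(1)] .
        have "\<beta> (Cod C f) (mod_map V f v) = \<zero>\<^bsub>mod_at B (Cod C f)\<^esub>"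
          using h v a 0 f by (auto simp: O_hom_def)
        then have "mod_map V f v \<in> torsion_part C J V (Cod C f)"
          using ker[OF y] V.mod_map_closed[OF a(1)] v a by simp
        then obtain S' where S': "S' \<in> J (Cod C f)"
          "\<forall>g\<in>S'. mod_map V g (mod_map V f v) = \<zero>\<^bsub>mod_at V (Cod C g)\<^esub>"
          by (auto simp: torsion_part_iff[OF V y])
        \<comment> \<open>An arrow killing the image of \<open>v\<close> along \<open>f\<close>
          becomes, after composition with \<open>f\<close>, an arrow killing
          \<open>v\<close>.\<close>
        have "S' \<subseteq> pullback C f T"
          using S' J_arr[OF y S'(1)] a v Comp_arr[of f] V.mod_map_Comp[of f]
          by (auto simp: pullback_def T_def representable_def)
        then show ?thesis
          using grothendieck_closed_under_inclusions[OF J] S' y J_subfunctor[OF y S'(1)]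
            subfunctor_pullback[OF T] a
          by (auto simp: closed_under_inclusions_def representable_def)
      qed
      then have "T \<in> J x"
        using J T x S by (auto simp: grothendieck_topology_def transitivity_axiom_def)
      then have "\<exists>S\<in>J x. \<forall>f\<in>S. mod_map V f v = \<zero>\<^bsub>mod_at V (Cod C f)\<^esub>"
        by (rule bexI[rotated]) (simp add: T_def)
      then have "v \<in> torsion_part C J V x"
        using v(1) torsion_part_iff[OF V x] by simp
      then show ?thesis using ker[OF x] v by simp
    qed
    then have "B \<in> torsion_free_class C R J" using B by (auto simp: torsion_free_class_iff)
    then show ?thesis using restrict_torsion_part[OF V] ex by blast
  qed
  then have ext: "\<forall>V\<in>O_Mod C R. \<exists>A\<in>torsion_class C R J. \<exists>B\<in>torsion_free_class C R J.
      \<exists>\<alpha> \<beta>. short_exact C R A \<alpha> (V :: ('o, 'm, 'r, 'v) omod) \<beta> B"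
    by (simp add: O_Mod_def)
  show ?thesis
    unfolding hereditary_torsion_pair_def torsion_pair_def
  proof (intro conjI ballI allI impI ext[rule_format])
    show "torsion_class C R J \<subseteq> O_Mod C R" "torsion_free_class C R J \<subseteq> O_Mod C R"
      by (auto simp: torsion_class_def torsion_free_class_def)
  qed (simp_all add: replete_torsion_class replete_torsion_free_class
      torsion_to_torsion_free_zero[where R = R] torsion_class_restrict)
qed

section \<open>A module in which every subfunctor is an annihilator\<close>

text \<open>The coinduced module whose value at \<open>y\<close> is the product of the rings at \<open>Cod C k\<close> over all
  \<open>k\<close> with domain \<open>y\<close>. Unlike for free modules, functoriality needs no sums over fibres, and
  every subfunctor is the annihilator of an element.\<close>

definition coinduced_module :: "('o, 'm) cat \<Rightarrow> ('o, 'm, 'r) rpsh \<Rightarrow> ('o, 'm, 'r, 'm \<Rightarrow> 'r) omod" where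
  "coinduced_module C R =
    \<lparr>mod_at = \<lambda>y. \<lparr>carrier = (\<Pi>\<^sub>E k\<in>representable C y. carrier (ring_at R (Cod C k))),
        mult = undefined, one = undefined,
        zero = (\<lambda>k\<in>representable C y. \<zero>\<^bsub>ring_at R (Cod C k)\<^esub>),
        add = \<lambda>\<phi> \<psi>. (\<lambda>k\<in>representable C y. \<phi> k \<oplus>\<^bsub>ring_at R (Cod C k)\<^esub> \<psi> k),
        smult = \<lambda>a \<phi>. (\<lambda>k\<in>representable C y. ring_map R k a \<otimes>\<^bsub>ring_at R (Cod C k)\<^esub> \<phi> k)\<rparr>,
     mod_map = \<lambda>h \<phi>. (\<lambda>k\<in>representable C (Cod C h). \<phi> (Comp C k h))\<rparr>"

context ring_presheaf
begin

text \<open>The module laws hold in each coordinate \<open>k\<close>, where scalars act through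
  \<open>ring_map R k\<close>. Structure maps only reindex coordinates by precomposition, so
  functoriality is associativity and the unit law of \<open>C\<close>.\<close>

lemma o_module_coinduced: "o_module C R (coinduced_module C R)"
proof (intro o_module.intro o_module_axioms.intro)
  show "ring_presheaf C R" by (rule ring_presheaf_axioms)
next
  fix x assume x: "x \<in> Obj C"
  let ?M = "mod_at (coinduced_module C R) x"
  have rg: "ring (ring_at R (Cod C k))" if "k \<in> representable C x" for k
    using that ring_at Cod_closed by (auto simp: representable_def)
  have ag: "abelian_group (ring_at R (Cod C k))" if "k \<in> representable C x" for k
    using ring.is_abelian_group[OF rg[OF that]] .
  have sr: "semiring (ring_at R (Cod C k))" if "k \<in> representable C x" for k
  proof -
    interpret ring "ring_at R (Cod C k)" by (rule rg[OF that])
    show ?thesis by (rule semiring_axioms)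
  qed
  have hom: "ring_map R k \<in> ring_hom (ring_at R x) (ring_at R (Cod C k))"
    if "k \<in> representable C x" for k
    using that ring_map by (auto simp: representable_def)
  note mem = PiE_mem[where S = "representable C x" and T = "\<lambda>k. carrier (ring_at R (Cod C k))"]
  have "abelian_group ?M"
  proof (rule abelian_groupI)
    fix \<phi> assume p: "\<phi> \<in> carrier ?M"
    let ?\<psi> = "\<lambda>k\<in>representable C x. \<ominus>\<^bsub>ring_at R (Cod C k)\<^esub> \<phi> k"
    have "?\<psi> \<in> carrier ?M"
      using p by (auto simp: coinduced_module_def mem abelian_group.a_inv_closed[OF ag])
    moreover have "?\<psi> \<oplus>\<^bsub>?M\<^esub> \<phi> = \<zero>\<^bsub>?M\<^esub>"
      using p
      by (auto simp: coinduced_module_def fun_eq_iff mem abelian_group.l_neg[OF ag])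
    ultimately show "\<exists>\<psi>\<in>carrier ?M. \<psi> \<oplus>\<^bsub>?M\<^esub> \<phi> = \<zero>\<^bsub>?M\<^esub>" by blast
  next
    fix \<phi> \<psi> \<chi> assume p: "\<phi> \<in> carrier ?M" "\<psi> \<in> carrier ?M" "\<chi> \<in> carrier ?M"
    from p show "\<phi> \<oplus>\<^bsub>?M\<^esub> \<psi> \<oplus>\<^bsub>?M\<^esub> \<chi> = \<phi> \<oplus>\<^bsub>?M\<^esub> (\<psi> \<oplus>\<^bsub>?M\<^esub> \<chi>)"
      by (auto simp: coinduced_module_def fun_eq_iff mem abelian_groupE(3)[OF ag])
  next
    fix \<phi> \<psi> assume p: "\<phi> \<in> carrier ?M" "\<psi> \<in> carrier ?M"
    from p show "\<phi> \<oplus>\<^bsub>?M\<^esub> \<psi> = \<psi> \<oplus>\<^bsub>?M\<^esub> \<phi>"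
      by (auto simp: coinduced_module_def fun_eq_iff mem abelian_groupE(4)[OF ag])
    show "\<phi> \<oplus>\<^bsub>?M\<^esub> \<psi> \<in> carrier ?M"
      using p
      by (auto simp: coinduced_module_def mem abelian_groupE(1)[OF ag])
  next
    fix \<phi> assume p: "\<phi> \<in> carrier ?M"
    \<comment> \<open>Here the result is compared with \<open>\<phi>\<close> itself, so its default
      value outside \<open>representable C x\<close> matters as well.\<close>
    then have "\<phi> \<in> (\<Pi>\<^sub>E k\<in>representable C x. carrier (ring_at R (Cod C k)))"
      by (simp add: coinduced_module_def)
    from mem[OF this] PiE_arb[OF this] show "\<zero>\<^bsub>?M\<^esub> \<oplus>\<^bsub>?M\<^esub> \<phi> = \<phi>"
      by (auto simp: coinduced_module_def fun_eq_iff abelian_groupE(5)[OF ag])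
  next
    show "\<zero>\<^bsub>?M\<^esub> \<in> carrier ?M"
      by (auto simp: coinduced_module_def abelian_groupE(2)[OF ag])
  qed
  then show "left_module (ring_at R x) ?M"
  proof (rule left_moduleI[OF ring_at[OF x]])
    fix a \<phi> assume a: "a \<in> carrier (ring_at R x)" and p: "\<phi> \<in> carrier ?M"
    show "a \<odot>\<^bsub>?M\<^esub> \<phi> \<in> carrier ?M"
      using p a
      by (auto simp: coinduced_module_def mem
        semiring.semiring_simprules(3)[OF sr] ring_hom_closed[OF hom])
  next
    fix a b \<phi> assume a: "a \<in> carrier (ring_at R x)" "b \<in> carrier (ring_at R x)"
      and p: "\<phi> \<in> carrier ?M"
    show "(a \<oplus>\<^bsub>ring_at R x\<^esub> b) \<odot>\<^bsub>?M\<^esub> \<phi> = a \<odot>\<^bsub>?M\<^esub> \<phi> \<oplus>\<^bsub>?M\<^esub> b \<odot>\<^bsub>?M\<^esub> \<phi>"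
      using p a
      by (auto simp: coinduced_module_def fun_eq_iff mem
        ring_hom_add[OF hom] semiring.l_distr[OF sr] ring_hom_closed[OF hom])
    show "(a \<otimes>\<^bsub>ring_at R x\<^esub> b) \<odot>\<^bsub>?M\<^esub> \<phi> = a \<odot>\<^bsub>?M\<^esub> (b \<odot>\<^bsub>?M\<^esub> \<phi>)"
      using p a
      by (auto simp: coinduced_module_def fun_eq_iff mem
        ring_hom_mult[OF hom] monoid.m_assoc[OF ring.is_monoid[OF rg]] ring_hom_closed[OF hom])
  next
    fix a \<phi> \<psi> assume a: "a \<in> carrier (ring_at R x)" and p: "\<phi> \<in> carrier ?M" "\<psi> \<in> carrier ?M"
    show "a \<odot>\<^bsub>?M\<^esub> (\<phi> \<oplus>\<^bsub>?M\<^esub> \<psi>) = a \<odot>\<^bsub>?M\<^esub> \<phi> \<oplus>\<^bsub>?M\<^esub> a \<odot>\<^bsub>?M\<^esub> \<psi>"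
      using p a
      by (auto simp: coinduced_module_def fun_eq_iff mem
        semiring.r_distr[OF sr] ring_hom_closed[OF hom])
  next
    fix \<phi> assume p: "\<phi> \<in> carrier ?M"
    then have "\<phi> \<in> (\<Pi>\<^sub>E k\<in>representable C x. carrier (ring_at R (Cod C k)))"
      by (simp add: coinduced_module_def)
    from mem[OF this] PiE_arb[OF this] show "\<one>\<^bsub>ring_at R x\<^esub> \<odot>\<^bsub>?M\<^esub> \<phi> = \<phi>"
      by (auto simp: coinduced_module_def fun_eq_iff
        ring_hom_one[OF hom] monoid.l_one[OF ring.is_monoid[OF rg]])
  qed
next
  fix f a v assume f: "f \<in> Arr C" and a: "a \<in> carrier (ring_at R (Dom C f))"
    and v: "v \<in> carrier (mod_at (coinduced_module C R) (Dom C f))"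
  \<comment> \<open>Precomposition with \<open>f\<close> preserves the codomain, so both coordinates
    lie in the same ring; functoriality of \<open>ring_map\<close> matches the scalars.\<close>
  have "Comp C k f \<in> representable C (Dom C f) \<and> Cod C (Comp C k f) = Cod C k \<and>
      ring_map R (Comp C k f) a = ring_map R k (ring_map R f a)"
    if "k \<in> representable C (Cod C f)" for k
    using that f a Comp_arr[of f k] ring_map_Comp[of f k a] by (auto simp: representable_def)
  then show "mod_map (coinduced_module C R) f (a \<odot>\<^bsub>mod_at (coinduced_module C R) (Dom C f)\<^esub> v)
      = ring_map R f a \<odot>\<^bsub>mod_at (coinduced_module C R) (Cod C f)\<^esub> mod_map (coinduced_module C R) f v"
    by (auto simp: coinduced_module_def fun_eq_iff)
next
  fix f v w assume f: "f \<in> Arr C"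
  have "Comp C k f \<in> representable C (Dom C f) \<and> Cod C (Comp C k f) = Cod C k"
    if "k \<in> representable C (Cod C f)" for k
    using that f Comp_arr[of f k] by (auto simp: representable_def)
  then show "mod_map (coinduced_module C R) f (v \<oplus>\<^bsub>mod_at (coinduced_module C R) (Dom C f)\<^esub> w)
      = mod_map (coinduced_module C R) f v \<oplus>\<^bsub>mod_at (coinduced_module C R) (Cod C f)\<^esub>
        mod_map (coinduced_module C R) f w"
    by (auto simp: coinduced_module_def fun_eq_iff)
next
  fix f v assume f: "f \<in> Arr C" and v: "v \<in> carrier (mod_at (coinduced_module C R) (Dom C f))"
  have "Comp C k f \<in> representable C (Dom C f) \<and> Cod C (Comp C k f) = Cod C k"
    if "k \<in> representable C (Cod C f)" for k
    using that f Comp_arr[of f k] by (auto simp: representable_def)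
  then show "mod_map (coinduced_module C R) f v \<in> carrier (mod_at (coinduced_module C R) (Cod C f))"
    using v by (fastforce simp: coinduced_module_def Pi_iff PiE_def)
next
  fix x v assume x: "x \<in> Obj C" and v: "v \<in> carrier (mod_at (coinduced_module C R) x)"
  have "Comp C k (Ident C x) = k" if "k \<in> representable C x" for k
    using that Comp_Ident_right by (auto simp: representable_def)
  moreover have "v \<in> (\<Pi>\<^sub>E k\<in>representable C x. carrier (ring_at R (Cod C k)))"
    using v by (simp add: coinduced_module_def)
  ultimately show "mod_map (coinduced_module C R) (Ident C x) v = v"
    using Ident_arr[OF x] PiE_arb[of v "representable C x"] by (auto simp: coinduced_module_def fun_eq_iff)
next
  fix f g v assume fg: "f \<in> Arr C" "g \<in> Arr C" "Cod C f = Dom C g"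
  have "Comp C k (Comp C g f) = Comp C (Comp C k g) f \<and> Comp C k g \<in> representable C (Cod C f)"
    if "k \<in> representable C (Cod C g)" for k
    using that fg Comp_assoc[of f g k] Comp_arr[of g k] by (auto simp: representable_def)
  then show "mod_map (coinduced_module C R) (Comp C g f) v
      = mod_map (coinduced_module C R) g (mod_map (coinduced_module C R) f v)"
    using Comp_arr[OF fg] by (auto simp: coinduced_module_def fun_eq_iff)
qed

text \<open>The witness is the indicator of the complement of \<open>T\<close>. Its image along
  \<open>f\<close> has value at \<open>Comp C k f\<close> as coordinate \<open>k\<close>: all these
  vanish if \<open>f\<close> is in \<open>T\<close>, and one of them equals the unit
  otherwise.\<close>

lemma ex_annihilator_coinduced:
  assumes nz: "\<forall>x\<in>Obj C. \<one>\<^bsub>ring_at R x\<^esub> \<noteq> \<zero>\<^bsub>ring_at R x\<^esub>" and T: "subfunctor C x T"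
  shows "\<exists>v\<in>carrier (mod_at (coinduced_module C R) x). \<forall>f\<in>representable C x.
    mod_map (coinduced_module C R) f v = \<zero>\<^bsub>mod_at (coinduced_module C R) (Cod C f)\<^esub> \<longleftrightarrow> f \<in> T"
proof (intro bexI ballI)
  let ?v = "\<lambda>k\<in>representable C x.
    if k \<in> T then \<zero>\<^bsub>ring_at R (Cod C k)\<^esub> else \<one>\<^bsub>ring_at R (Cod C k)\<^esub>"
  show "?v \<in> carrier (mod_at (coinduced_module C R) x)"
  proof -
    have "ring (ring_at R (Cod C k))" if "k \<in> representable C x" for k
      using that ring_at Cod_closed by (auto simp: representable_def)
    then show ?thesis
      by (auto simp: coinduced_module_def ring.ring_simprules(2) ring.ring_simprules(6))
  qed
  fix f assume f: "f \<in> representable C x"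
  have a: "f \<in> Arr C" "Dom C f = x" using f by (auto simp: representable_def)
  have eval: "mod_map (coinduced_module C R) f ?v k =
      (if Comp C k f \<in> T then \<zero>\<^bsub>ring_at R (Cod C k)\<^esub> else \<one>\<^bsub>ring_at R (Cod C k)\<^esub>)"
    if "k \<in> representable C (Cod C f)" for k
    using that representable_closed[OF f that] by (simp add: coinduced_module_def)
  show "mod_map (coinduced_module C R) f ?v = \<zero>\<^bsub>mod_at (coinduced_module C R) (Cod C f)\<^esub> \<longleftrightarrow> f \<in> T"
  proof
    assume eq: "mod_map (coinduced_module C R) f ?v = \<zero>\<^bsub>mod_at (coinduced_module C R) (Cod C f)\<^esub>"
    \<comment> \<open>The coordinate at the identity recovers the value of the indicator at
      \<open>f\<close> itself, and zero differs from one there.\<close>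
    let ?i = "Ident C (Cod C f)"
    have i: "?i \<in> representable C (Cod C f)" "Cod C ?i = Cod C f" "Comp C ?i f = f"
      using Ident_arr[OF Cod_closed] Comp_Ident_left a by (auto simp: representable_def)
    have "mod_map (coinduced_module C R) f ?v ?i = \<zero>\<^bsub>ring_at R (Cod C f)\<^esub>"
      using i unfolding eq by (simp add: coinduced_module_def)
    then show "f \<in> T"
      using eval[OF i(1)] i nz Cod_closed[OF a(1)] by (auto split: if_splits)
  next
    assume "f \<in> T"
    then have "Comp C k f \<in> T" if "k \<in> representable C (Cod C f)" for k
      using that T by (auto simp: subfunctor_def representable_def)
    then show "mod_map (coinduced_module C R) f ?v = \<zero>\<^bsub>mod_at (coinduced_module C R) (Cod C f)\<^esub>"
      using eval by (auto simp: coinduced_module_def fun_eq_iff)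
  qed
qed

text \<open>The torsion pair speaks only of modules with elements in \<open>'v\<close>, so the
  coinduced module is carried over along the injection \<open>e\<close>.\<close>

lemma ex_annihilator:
  fixes e :: "('m \<Rightarrow> 'r) \<Rightarrow> 'v"
  assumes e: "inj e"
    and nz: "\<forall>x\<in>Obj C. \<one>\<^bsub>ring_at R x\<^esub> \<noteq> \<zero>\<^bsub>ring_at R x\<^esub>"
    and x: "x \<in> Obj C" and T: "subfunctor C x T"
  obtains M :: "('o, 'm, 'r, 'v) omod" and v where "o_module C R M" "v \<in> carrier (mod_at M x)"
    "\<And>f. f \<in> representable C x \<Longrightarrow> mod_map M f v = \<zero>\<^bsub>mod_at M (Cod C f)\<^esub> \<longleftrightarrow> f \<in> T"
proof -
  let ?V = "coinduced_module C R"
  interpret V: o_module C R ?V by (rule o_module_coinduced)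
  \<comment> \<open>Under an injection equal values mean equal elements, so the congruence
    conditions are immediate.\<close>
  interpret V: o_module_congruence C R ?V "\<lambda>_. e"
    by unfold_locales (auto dest: injD[OF e])
  obtain v where v: "v \<in> carrier (mod_at ?V x)"
    "\<And>f. f \<in> representable C x \<Longrightarrow> mod_map ?V f v = \<zero>\<^bsub>mod_at ?V (Cod C f)\<^esub> \<longleftrightarrow> f \<in> T"
    using ex_annihilator_coinduced[OF nz T] by blast
  show ?thesis
  proof (rule that[OF V.o_module_image])
    show "e v \<in> carrier (mod_at (image_module (\<lambda>_. e) C ?V) x)"
      using v by (simp add: V.image_carrier)
    fix f assume f: "f \<in> representable C x"
    then have "mod_map (image_module (\<lambda>_. e) C ?V) f (e v) = e (mod_map ?V f v)"
      using V.image_map[of f v] v by (simp add: representable_def)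
    then show "mod_map (image_module (\<lambda>_. e) C ?V) f (e v)
        = \<zero>\<^bsub>mod_at (image_module (\<lambda>_. e) C ?V) (Cod C f)\<^esub> \<longleftrightarrow> f \<in> T"
      using v(2)[OF f] by (simp add: V.image_zero inj_eq[OF e])
  qed
qed

section \<open>From torsion pairs to transitivity\<close>

lemma torsion_pair_transitive:
  fixes J :: "'o \<Rightarrow> 'm set set" and e :: "('m \<Rightarrow> 'r) \<Rightarrow> 'v"
  assumes J: "directed_rule C J" and incl: "closed_under_inclusions C J"
    and e: "inj e" and nz: "\<forall>x\<in>Obj C. \<one>\<^bsub>ring_at R x\<^esub> \<noteq> \<zero>\<^bsub>ring_at R x\<^esub>"
    and tp: "torsion_pair C R
      (torsion_class C R J :: ('o, 'm, 'r, 'v) omod set) (torsion_free_class C R J)"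
  shows "transitivity_axiom C J"
  unfolding transitivity_axiom_def
proof (intro ballI allI impI)
  interpret directed_rule C J by (rule J)
  fix x S T assume x: "x \<in> Obj C" and S: "S \<in> J x" and T: "subfunctor C x T"
    and ST: "\<forall>f\<in>S. pullback C f T \<in> J (Cod C f)"
  obtain M :: "('o, 'm, 'r, 'v) omod" and v where M: "o_module C R M" and v: "v \<in> carrier (mod_at M x)"
    and ann: "\<And>f. f \<in> representable C x \<Longrightarrow> mod_map M f v = \<zero>\<^bsub>mod_at M (Cod C f)\<^esub> \<longleftrightarrow> f \<in> T"
    using ex_annihilator[OF e nz x T] by metis
  interpret M: o_module C R M by (rule M)
  obtain A B :: "('o, 'm, 'r, 'v) omod" and \<alpha> \<beta>
    where A: "A \<in> torsion_class C R J" and B: "B \<in> torsion_free_class C R J"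
    and ex: "short_exact C R A \<alpha> M \<beta> B"
    using tp M unfolding torsion_pair_def O_Mod_def by blast
  have AB: "o_module C R A" "o_module C R B"
    using A B by (auto simp: torsion_class_iff torsion_free_class_iff)
  have h: "\<alpha> \<in> O_hom C R A M" "\<beta> \<in> O_hom C R M B" using ex by (auto simp: short_exact_def)
  \<comment> \<open>Torsion-freeness of \<open>B\<close> is used twice: here at
    \<open>Cod C f\<close> with the covering pullback of \<open>T\<close>, and afterwards at
    \<open>x\<close> with \<open>S\<close>.\<close>
  have "mod_map B f (\<beta> x v) = \<zero>\<^bsub>mod_at B (Cod C f)\<^esub>" if f: "f \<in> S" for f
  proof -
    have a: "f \<in> Arr C" "Dom C f = x" using J_arr[OF x S f] by auto
    have y: "Cod C f \<in> Obj C" using Cod_closed[OF a(1)] .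
    have fv: "mod_map M f v \<in> carrier (mod_at M (Cod C f))"
      using M.mod_map_closed[OF a(1)] v a by simp
    have "mod_map B g (\<beta> (Cod C f) (mod_map M f v)) = \<zero>\<^bsub>mod_at B (Cod C g)\<^esub>"
      if "g \<in> pullback C f T" for g
    proof -
      have g: "g \<in> Arr C" "Dom C g = Cod C f" "Comp C g f \<in> T"
        using that by (auto simp: pullback_def representable_def)
      have "mod_map B g (\<beta> (Cod C f) (mod_map M f v)) = \<beta> (Cod C g) (mod_map M g (mod_map M f v))"
        using h(2) g fv by (auto simp: O_hom_def)
      also have "mod_map M g (mod_map M f v) = \<zero>\<^bsub>mod_at M (Cod C g)\<^esub>"
        using M.mod_map_Comp[of f g v] ann[of "Comp C g f"] a g v Comp_arr[of f g]
        by (simp add: representable_def)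
      finally show ?thesis using O_hom_zero[OF M AB(2) h(2) Cod_closed[OF g(1)]] by simp
    qed
    moreover have "\<beta> (Cod C f) (mod_map M f v) \<in> carrier (mod_at B (Cod C f))"
      using h(2) y fv by (auto simp: O_hom_def)
    ultimately have "\<beta> (Cod C f) (mod_map M f v) = \<zero>\<^bsub>mod_at B (Cod C f)\<^esub>"
      using B y ST f torsion_free_class_iff[of B] by blast
    then show ?thesis using h(2) a v by (auto simp: O_hom_def)
  qed
  moreover have "\<beta> x v \<in> carrier (mod_at B x)" using h(2) x v by (auto simp: O_hom_def)
  ultimately have "\<beta> x v = \<zero>\<^bsub>mod_at B x\<^esub>"
    using B x S torsion_free_class_iff[of B] by blast
  \<comment> \<open>By exactness \<open>v\<close> comes from the torsion module \<open>A\<close>, so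
    some member of \<open>J x\<close> kills its preimage.\<close>
  then have "v \<in> \<alpha> x ` carrier (mod_at A x)" using ex x v by (simp add: short_exact_def)
  then obtain u where u: "u \<in> carrier (mod_at A x)" "v = \<alpha> x u" by blast
  then obtain S' where S': "S' \<in> J x" "\<forall>f\<in>S'. mod_map A f u = \<zero>\<^bsub>mod_at A (Cod C f)\<^esub>"
    using A x torsion_class_iff[of A] by blast
  \<comment> \<open>What kills \<open>u\<close> in \<open>A\<close> kills \<open>v\<close> in
    \<open>M\<close>, and \<open>T\<close> is precisely the annihilator of \<open>v\<close>.\<close>
  have "f \<in> T" if f: "f \<in> S'" for f
  proof -
    have a: "f \<in> Arr C" "Dom C f = x" using J_arr[OF x S'(1) f] by auto
    have "mod_map M f v = \<alpha> (Cod C f) (mod_map A f u)"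
      using h(1) u a by (auto simp: O_hom_def)
    then have "mod_map M f v = \<zero>\<^bsub>mod_at M (Cod C f)\<^esub>"
      using S' f O_hom_zero[OF AB(1) M h(1) Cod_closed[OF a(1)]] by simp
    then show ?thesis using ann a by (simp add: representable_def)
  qed
  then show "T \<in> J x"
    using incl S' J_subfunctor[OF x S'(1)] T x unfolding closed_under_inclusions_def by blast
qed

end

text \<open>The extra premises of the converse let modules detect \<open>J\<close>. The injection
  makes room in \<open>'v\<close> for the coinduced module; over zero rings all modules vanish; the
  constantly empty rule has only zero modules as torsion and every module as torsion free; closure
  under intersections turns the sum defining the torsion part into a union.\<close>

theorem proposition3p13:
  fixes C :: "('o, 'm) cat"
    and R :: "('o, 'm, 'r) rpsh"
    and J :: "'o \<Rightarrow> 'm set set"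
  assumes "category C" and "skeletal C"
    and "ring_presheaf C R"
    and "is_rule C J" and "stability_axiom C J"
  shows "(grothendieck_topology C J \<longrightarrow>
            hereditary_torsion_pair C R
              (torsion_class C R J :: ('o, 'm, 'r, 'v) omod set) (torsion_free_class C R J)) \<and>
         ((\<exists>e :: ('m \<Rightarrow> 'r) \<Rightarrow> 'v. inj e) \<longrightarrow>
          (\<forall>x\<in>Obj C. \<one>\<^bsub>ring_at R x\<^esub> \<noteq> \<zero>\<^bsub>ring_at R x\<^esub>) \<longrightarrow>
          (\<forall>x\<in>Obj C. J x \<noteq> {}) \<longrightarrow>
          (\<forall>x\<in>Obj C. \<forall>S\<in>J x. \<forall>T\<in>J x. S \<inter> T \<in> J x) \<longrightarrow>
          closed_under_inclusions C J \<longrightarrow>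
          hereditary_torsion_pair C R
            (torsion_class C R J :: ('o, 'm, 'r, 'v) omod set) (torsion_free_class C R J) \<longrightarrow>
          grothendieck_topology C J)"
proof (intro conjI impI)
  interpret ring_presheaf C R by fact
  assume "grothendieck_topology C J"
  then show "hereditary_torsion_pair C R
      (torsion_class C R J :: ('o, 'm, 'r, 'v) omod set) (torsion_free_class C R J)"
    by (rule grothendieck_hereditary)
next
  interpret ring_presheaf C R by fact
  assume "\<exists>e :: ('m \<Rightarrow> 'r) \<Rightarrow> 'v. inj e"
    and nz: "\<forall>x\<in>Obj C. \<one>\<^bsub>ring_at R x\<^esub> \<noteq> \<zero>\<^bsub>ring_at R x\<^esub>"
    and ne: "\<forall>x\<in>Obj C. J x \<noteq> {}"
    and Int: "\<forall>x\<in>Obj C. \<forall>S\<in>J x. \<forall>T\<in>J x. S \<inter> T \<in> J x"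
    and incl: "closed_under_inclusions C J"
    and tp: "hereditary_torsion_pair C R
      (torsion_class C R J :: ('o, 'm, 'r, 'v) omod set) (torsion_free_class C R J)"
  then obtain e :: "('m \<Rightarrow> 'r) \<Rightarrow> 'v" where e: "inj e" by blast
  have J: "directed_rule C J"
    using assms ne Int by unfold_locales auto
  \<comment> \<open>Any member of the nonempty \<open>J x\<close> is contained in the representable,
    so closure under inclusions suffices.\<close>
  have "maximal_axiom C J"
    unfolding maximal_axiom_def
  proof
    fix x assume x: "x \<in> Obj C"
    then obtain S where S: "S \<in> J x" using ne by blast
    then have "subfunctor C x S" using assms(4) x by (simp add: is_rule_def)
    moreover from this have "S \<subseteq> representable C x" by (simp add: subfunctor_def)
    ultimately show "representable C x \<in> J x"
      using incl x S subfunctor_representable[of x] unfolding closed_under_inclusions_def by blast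
  qed
  moreover have "transitivity_axiom C J"
    using torsion_pair_transitive[OF J incl e nz] tp by (simp add: hereditary_torsion_pair_def)
  ultimately show "grothendieck_topology C J"
    using assms by (simp add: grothendieck_topology_def)
qed

end
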